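(* Let $K=\sqrt{(z_x-zz_y)^2+4z^3}$ and $$\begin{aligned} Z={}&\frac{z^3}{K^3}(z_{xxx}-z z_{xxy})-\frac{3}{K^5}z^3(z_x-zz_y)(z_{xx}-zz_{xy})^2\\ &-\frac{2}{K^5}z^5(9z_x-zz_y)z_{xx}+\frac{1}{2K^5}z^2(9z_x^2+4zz_xz_y-z^2z_y^2)(z_x-zz_y)z_{xx}\\ &-\frac{2}{K^5}z^3z_x(z_x-zz_y)(4z_x-zz_y)z_{xy}+\frac{4}{K^5}z^6z_xz_{xy}\\ &+\frac{3}{K^5}z^4(5z_x-zz_y)z_x^2-\frac{3}{K^5}z(z_x-zz_y)z_x^4 . \end{aligned}$$ Then $Z$ is the generator of a (third-order) symmetry of the equation $$z_{yy}+\left(\frac1z\right)_{xx}+2=0,$$ and the expression obtained from $Z$ by conjugation with the discrete symmetry $x\to y$, $y\to x$, $z\to 1/z$ of this equation is the generator of another third-order symmetry.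
   Context: The equation $z_{yy}+(1/z)_{xx}+2=0$ for an unknown function $z(x,y)$ is called the constant astigmatism equation. A function $Z$ of $z$ and finitely many of its $x,y$-derivatives is the generator (characteristic) of a symmetry of the equation if it satisfies the linearized equation $$D_y^2Z-D_x^2\left(\frac{Z}{z^2}\right)=0$$ as a consequence of the equation and its differential consequences, i.e. on all solutions $z$; here $D_x,D_y$ are total derivatives. The symmetry is of third order if $Z$ depends on derivatives of $z$ up to order three. Conjugation of a generator $Z$ with the discrete symmetry $x\to y$, $y\to x$, $z\to1/z$ means transporting the infinitesimal symmetry by this transformation: if $\hat Z$ denotes the expression $Z$ with $z$ replaced by $1/z$ and the roles of $x$ and $y$ interchanged (so that each derivative $\partial_x^i\partial_y^jz$ is replaced by $D_y^iD_x^j(1/z)$), then the conjugated generator is $-z^2\hat Z$. All considerations are local, with $z>0$, so that $K\neq0$. *)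

theory Defs
  imports "HOL-Analysis.Analysis"
begin

section \<open>Differential functions on infinite jets\<close>

text \<open>A point of the infinite jet space is a family \<open>u\<close> of reals, where \<open>u (i, j)\<close> is the
  coordinate of the derivative of \<open>z\<close> taken \<open>i\<close> times in \<open>x\<close> and \<open>j\<close> times in \<open>y\<close>.
  There is no coordinate for the base point, because no function considered here depends
  explicitly on \<open>x, y\<close>.\<close>

type_synonym jet = "nat \<times> nat \<Rightarrow> real"

definition jet_domain :: "jet set" where
  "jet_domain = {u. u (0, 0) > 0}"

definition partial :: "nat \<times> nat \<Rightarrow> (jet \<Rightarrow> real) \<Rightarrow> jet \<Rightarrow> real" where
  "partial p F u = deriv (\<lambda>t. F (u(p := t))) (u p)"

definition depends_up_to :: "nat \<Rightarrow> (jet \<Rightarrow> real) \<Rightarrow> bool" where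
  "depends_up_to n F \<longleftrightarrow>
     (\<forall>u\<in>jet_domain. \<forall>v\<in>jet_domain.
        (\<forall>i j. i + j \<le> n \<longrightarrow> u (i, j) = v (i, j)) \<longrightarrow> F u = F v)"

text \<open>Jets carry the product topology; for a function of finitely many coordinates, continuity
  in it is ordinary continuity, so that the following is ordinary smoothness: all iterated
  partial derivatives exist and are continuous.\<close>

definition smooth_jet_function :: "(jet \<Rightarrow> real) \<Rightarrow> bool" where
  "smooth_jet_function F \<longleftrightarrow>
     (\<forall>ps. continuous_on jet_domain (foldr partial ps F) \<and>
        (\<forall>u\<in>jet_domain. \<forall>p.
           (\<lambda>t. foldr partial ps F (u(p := t))) differentiable (at (u p))))"

definition differential_function :: "(jet \<Rightarrow> real) \<Rightarrow> bool" where
  "differential_function F \<longleftrightarrow> (\<exists>n. depends_up_to n F) \<and> smooth_jet_function F"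

text \<open>The sums run over the coordinates with nonvanishing partial derivative. For a differential
  function there are only finitely many of these at each point of \<^term>\<open>jet_domain\<close>.\<close>

definition Dx :: "(jet \<Rightarrow> real) \<Rightarrow> jet \<Rightarrow> real" where
  "Dx F u = (\<Sum>(i, j)\<in>{p. partial p F u \<noteq> 0}. partial (i, j) F u * u (i + 1, j))"

definition Dy :: "(jet \<Rightarrow> real) \<Rightarrow> jet \<Rightarrow> real" where
  "Dy F u = (\<Sum>(i, j)\<in>{p. partial p F u \<noteq> 0}. partial (i, j) F u * u (i, j + 1))"

section \<open>The constant astigmatism equation and its symmetries\<close>

definition cae :: "jet \<Rightarrow> real" where
  "cae u = u (0, 2) + Dx (Dx (\<lambda>v. 1 / v (0, 0))) u + 2"

text \<open>The infinitely prolonged equation: the equation with all its differential consequences.\<close>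

definition cae_jets :: "jet set" where
  "cae_jets = {u \<in> jet_domain. \<forall>i j. (Dx ^^ i) ((Dy ^^ j) cae) u = 0}"

definition symmetry_generator :: "(jet \<Rightarrow> real) \<Rightarrow> bool" where
  "symmetry_generator Z \<longleftrightarrow> differential_function Z \<and>
     (\<forall>u\<in>cae_jets. Dy (Dy Z) u - Dx (Dx (\<lambda>v. Z v / (v (0, 0))\<^sup>2)) u = 0)"

definition third_order :: "(jet \<Rightarrow> real) \<Rightarrow> bool" where
  "third_order Z \<longleftrightarrow> depends_up_to 3 Z \<and> \<not> depends_up_to 2 Z"

text \<open>Action on jets of the discrete symmetry \<open>x \<rightarrow> y\<close>, \<open>y \<rightarrow> x\<close>, \<open>z \<rightarrow> 1/z\<close>, and conjugation of
  generators by it.\<close>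

definition swap_jet :: "jet \<Rightarrow> jet" where
  "swap_jet u = (\<lambda>(i, j). (Dy ^^ i) ((Dx ^^ j) (\<lambda>v. 1 / v (0, 0))) u)"

definition conjugate :: "(jet \<Rightarrow> real) \<Rightarrow> jet \<Rightarrow> real" where
  "conjugate Z u = - (u (0, 0))\<^sup>2 * Z (swap_jet u)"

section \<open>The generator\<close>

definition Z_gen :: "jet \<Rightarrow> real" where
  "Z_gen u =
    (let z = u (0, 0); z_x = u (1, 0); z_y = u (0, 1);
         z_xx = u (2, 0); z_xy = u (1, 1); z_xxx = u (3, 0); z_xxy = u (2, 1);
         K = sqrt ((z_x - z * z_y)^2 + 4 * z^3)
     in z^3 / K^3 * (z_xxx - z * z_xxy)
        - 3 / K^5 * z^3 * (z_x - z * z_y) * (z_xx - z * z_xy)^2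
        - 2 / K^5 * z^5 * (9 * z_x - z * z_y) * z_xx
        + 1 / (2 * K^5) * z^2 * (9 * z_x^2 + 4 * z * z_x * z_y - z^2 * z_y^2)
            * (z_x - z * z_y) * z_xx
        - 2 / K^5 * z^3 * z_x * (z_x - z * z_y) * (4 * z_x - z * z_y) * z_xy
        + 4 / K^5 * z^6 * z_x * z_xy
        + 3 / K^5 * z^4 * (5 * z_x - z * z_y) * z_x^2
        - 3 / K^5 * z * (z_x - z * z_y) * z_x^4)"

end

theory Submission
  imports Defs
begin

text \<open>
  Write \<open>X\<^sub>\<plusminus> = D\<^sub>x \<plusminus> z D\<^sub>y\<close> for the characteristic derivations of the equation and put \<open>s = \<surd>z\<close>,
  \<open>Y\<^sub>\<plusminus> = X\<^sub>\<plusminus> / s\<close>, \<open>S = X\<^sub>-z / (2s\<^sup>3)\<close>, \<open>T = X\<^sub>+z / (2s\<^sup>3)\<close>, \<open>C = \<surd>(1 + S\<^sup>2)\<close>, so that \<open>K = 2s\<^sup>3C\<close>.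
  In these terms the equation becomes \<open>Y\<^sub>+S = 1 + S\<^sup>2\<close>, equivalently \<open>Y\<^sub>-T = 1 + T\<^sup>2\<close>, while the
  identities \<open>Y\<^sub>+s = sT\<close>, \<open>Y\<^sub>-s = sS\<close> and \<open>[Y\<^sub>+, Y\<^sub>-] = - T Y\<^sub>+ + S Y\<^sub>-\<close> hold for every \<open>z\<close>.
  With \<open>w = Y\<^sub>-(S/C)\<close> one gets \<open>Y\<^sub>+w = - T/C\<close>, and on the equation the long expression \<open>Z\<close> collapses to
  \<open>z (Y\<^sub>-w + T w) / 16\<close>. For \<open>V = Y\<^sub>-w + T w\<close> the symmetry condition becomes
  \<open>Y\<^sub>-Y\<^sub>+V = 2T Y\<^sub>+V + S Y\<^sub>-V + (Y\<^sub>+T + Y\<^sub>-S - 2ST) V\<close>, which is checked directly. The discrete symmetry acts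
  by \<open>s \<rightarrow> 1/s\<close>, \<open>T \<rightarrow> - T\<close>, \<open>Y\<^sub>- \<rightarrow> - Y\<^sub>-\<close> and fixes \<open>S\<close> and \<open>Y\<^sub>+\<close>; hence on the equation the conjugate of \<open>Z\<close>
  equals \<open>- Z\<close>.
\<close>

section \<open>Perturbing one coordinate inside the jet domain\<close>

lemma eventually_upd_jet_domain:
  assumes "u \<in> jet_domain"
  shows "\<forall>\<^sub>F t in nhds (u p). u(p := t) \<in> jet_domain"
proof (cases "p = (0, 0)")
  case True
  have "\<forall>\<^sub>F t in nhds (u p). t > 0"
    using assms True by (intro order_tendstoD(1)[where f = "\<lambda>t. t"]) (auto simp: jet_domain_def filterlim_ident)
  then show ?thesis using True by (auto simp: jet_domain_def)
qed (use assms in \<open>auto simp: jet_domain_def\<close>)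

lemma eventually_eq_upd:
  assumes "\<And>v. v \<in> jet_domain \<Longrightarrow> F v = G v" "u \<in> jet_domain"
  shows "\<forall>\<^sub>F t in nhds (u p). F (u(p := t)) = G (u(p := t))"
  using eventually_upd_jet_domain[OF assms(2), of p] by (rule eventually_mono) (rule assms(1))

text \<open>Positivity of z is an open condition, so functions that agree on
  \<open>jet_domain\<close> also agree under small changes of one coordinate, and their derivatives
  in that coordinate coincide.\<close>

lemma partial_cong:
  assumes "\<And>v. v \<in> jet_domain \<Longrightarrow> F v = G v" "u \<in> jet_domain"
  shows "partial p F u = partial p G u"
  unfolding partial_def by (rule deriv_cong_ev[OF eventually_eq_upd[OF assms] refl])

section \<open>Elementary differential functions\<close>

(* A class that is closed under partial and total derivatives by construction: smoothness, and the
   commutation of total derivatives, follow by induction without any theorem on mixed partial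
   derivatives. *)
inductive_set elem :: "(jet \<Rightarrow> real) set" where
  elem_coord: "(\<lambda>u. u p) \<in> elem"
| elem_const: "(\<lambda>u. c) \<in> elem"
| elem_add: "F \<in> elem \<Longrightarrow> G \<in> elem \<Longrightarrow> (\<lambda>u. F u + G u) \<in> elem"
| elem_mult: "F \<in> elem \<Longrightarrow> G \<in> elem \<Longrightarrow> (\<lambda>u. F u * G u) \<in> elem"
| elem_powr: "F \<in> elem \<Longrightarrow> (\<And>u. u \<in> jet_domain \<Longrightarrow> F u > 0) \<Longrightarrow> (\<lambda>u. F u powr c) \<in> elem"
| elem_cong: "F \<in> elem \<Longrightarrow> (\<And>u. u \<in> jet_domain \<Longrightarrow> G u = F u) \<Longrightarrow> G \<in> elem"

lemma elem_minus: "F \<in> elem \<Longrightarrow> (\<lambda>u. - F u) \<in> elem"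
  by (rule elem_cong[OF elem_mult[OF elem_const[of "-1"]]]) auto

lemma elem_diff: "F \<in> elem \<Longrightarrow> G \<in> elem \<Longrightarrow> (\<lambda>u. F u - G u) \<in> elem"
  by (rule elem_cong[OF elem_add[OF _ elem_minus]]) auto

lemma elem_power: "F \<in> elem \<Longrightarrow> (\<lambda>u. F u ^ n) \<in> elem"
proof (induction n)
  case (Suc n)
  then show ?case by (simp add: elem_mult)
qed (simp add: elem_const)

lemma elem_sqrt:
  "F \<in> elem \<Longrightarrow> (\<And>u. u \<in> jet_domain \<Longrightarrow> F u > 0) \<Longrightarrow> (\<lambda>u. sqrt (F u)) \<in> elem"
  by (rule elem_cong[OF elem_powr[of F "1/2"]]) (auto simp: powr_half_sqrt less_imp_le)

lemma elem_divide:
  "F \<in> elem \<Longrightarrow> G \<in> elem \<Longrightarrow> (\<And>u. u \<in> jet_domain \<Longrightarrow> G u > 0) \<Longrightarrow> (\<lambda>u. F u / G u) \<in> elem"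
  by (rule elem_cong[OF elem_mult[OF _ elem_powr[of G "-1"]]])
    (auto simp: powr_minus_divide less_imp_le)

lemma elem_divide_const: "F \<in> elem \<Longrightarrow> (\<lambda>u. F u / c) \<in> elem"
  unfolding divide_inverse by (intro elem_mult elem_const)

lemmas elem_intros = elem_coord elem_const elem_add elem_mult elem_minus elem_diff elem_power
  elem_divide_const

text \<open>\<open>partial\<close> is a \<open>deriv\<close> and carries information only once a
  derivative exists. Existence follows by induction over the construction of
  \<open>F\<close>.\<close>

lemma elem_DERIV:
  assumes "F \<in> elem" "u \<in> jet_domain"
  shows "((\<lambda>t. F (u(p := t))) has_real_derivative partial p F u) (at (u p))"
proof -
  have "(\<lambda>t. F (u(p := t))) differentiable at (u p)"
    using assms
  proof (induction)
    case (elem_coord q)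
    then show ?case by (cases "p = q") auto
  next
    case (elem_powr F c)
    then obtain d where "((\<lambda>t. F (u(p := t))) has_real_derivative d) (at (u p))"
      unfolding real_differentiable_def by blast
    moreover have "F u > 0" using elem_powr by auto
    ultimately have "((\<lambda>t. F (u(p := t)) powr c) has_real_derivative
        c * F (u(p := u p)) powr (c - of_nat 1) * d) (at (u p))"
      using DERIV_fun_powr[of "\<lambda>t. F (u(p := t))" d "u p" c] by simp
    then show ?case unfolding real_differentiable_def by blast
  next
    case (elem_cong F G)
    then obtain d where "((\<lambda>t. F (u(p := t))) has_real_derivative d) (at (u p))"
      unfolding real_differentiable_def by blast
    moreover have "\<forall>\<^sub>F t in nhds (u p). F (u(p := t)) = G (u(p := t))"
      using elem_cong by (intro eventually_eq_upd) auto
    ultimately have "((\<lambda>t. G (u(p := t))) has_real_derivative d) (at (u p))"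
      by (simp only: DERIV_cong_ev[OF refl _ refl])
    then show ?case unfolding real_differentiable_def by blast
  qed auto
  then show ?thesis
    unfolding partial_def by (auto simp: real_differentiable_def dest: DERIV_imp_deriv)
qed

section \<open>Partial derivatives and smoothness of elementary functions\<close>

lemma partial_eqI:
  "((\<lambda>t. F (u(p := t))) has_real_derivative d) (at (u p)) \<Longrightarrow> partial p F u = d"
  unfolding partial_def by (rule DERIV_imp_deriv)

lemma partial_coord: "partial p (\<lambda>u. u q) u = (if p = q then 1 else 0)"
  by (rule partial_eqI) (auto intro!: derivative_eq_intros)

lemma partial_const: "partial p (\<lambda>u. c) u = 0"
  by (rule partial_eqI) (auto intro!: derivative_eq_intros)

lemma partial_add:
  "F \<in> elem \<Longrightarrow> G \<in> elem \<Longrightarrow> u \<in> jet_domain \<Longrightarrow>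
    partial p (\<lambda>u. F u + G u) u = partial p F u + partial p G u"
  by (rule partial_eqI) (intro DERIV_add elem_DERIV)

lemma partial_mult:
  assumes "F \<in> elem" "G \<in> elem" "u \<in> jet_domain"
  shows "partial p (\<lambda>u. F u * G u) u = F u * partial p G u + partial p F u * G u"
  using DERIV_mult[OF elem_DERIV[OF assms(1,3), of p] elem_DERIV[OF assms(2,3), of p]]
  by (intro partial_eqI) (simp add: algebra_simps)

lemma partial_powr:
  assumes "F \<in> elem" "\<And>u. u \<in> jet_domain \<Longrightarrow> F u > 0" "u \<in> jet_domain"
  shows "partial p (\<lambda>u. F u powr c) u = c * F u powr (c - 1) * partial p F u"
  using DERIV_fun_powr[OF elem_DERIV[OF assms(1,3), of p], of c] assms(2)[OF assms(3)]
  by (intro partial_eqI) simp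

lemma partial_elem: "F \<in> elem \<Longrightarrow> partial p F \<in> elem"
proof (induction rule: elem.induct)
  case (elem_coord q)
  show ?case by (rule elem_cong[OF elem_const]) (rule partial_coord)
next
  case (elem_const c)
  show ?case by (rule elem_cong[OF elem.elem_const]) (rule partial_const)
next
  case (elem_add F G)
  show ?case by (rule elem_cong[OF elem.elem_add]) (use elem_add in \<open>auto simp: partial_add\<close>)
next
  case (elem_mult F G)
  show ?case
    by (rule elem_cong[of "\<lambda>u. F u * partial p G u + partial p F u * G u"])
      (use elem_mult in \<open>auto simp: partial_mult intro: elem_intros\<close>)
next
  case (elem_powr F c)
  show ?case
    by (rule elem_cong[of "\<lambda>u. c * F u powr (c - 1) * partial p F u"])
      (use elem_powr in \<open>auto simp: partial_powr intro!: elem_intros elem.elem_powr\<close>)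
next
  case (elem_cong F G)
  show ?case
    by (rule elem.elem_cong[of "partial p F"]) (use elem_cong in \<open>auto intro: partial_cong\<close>)
qed

lemma elem_continuous_on: "F \<in> elem \<Longrightarrow> continuous_on jet_domain F"
proof (induction rule: elem.induct)
  case (elem_coord q)
  show ?case by (rule continuous_on_subset[OF continuous_on_product_coordinates]) auto
next
  case (elem_powr F c)
  then show ?case by (intro continuous_on_powr) (auto simp: less_imp_neq[THEN not_sym])
next
  case (elem_cong F G)
  then show ?case by (simp cong: continuous_on_cong)
qed (auto intro: continuous_intros)

lemma elem_smooth:
  assumes "F \<in> elem"
  shows "smooth_jet_function F"
proof -
  have "foldr partial ps F \<in> elem" for ps
    by (induction ps) (auto intro: assms partial_elem)
  then show ?thesis
    unfolding smooth_jet_function_def real_differentiable_def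
    by (blast intro: elem_continuous_on elem_DERIV)
qed

section \<open>Dependence on finitely many coordinates\<close>

definition depends_on :: "(nat \<times> nat) set \<Rightarrow> (jet \<Rightarrow> real) \<Rightarrow> bool" where
  "depends_on P F \<longleftrightarrow>
    (\<forall>u\<in>jet_domain. \<forall>v\<in>jet_domain. (\<forall>p\<in>P. u p = v p) \<longrightarrow> F u = F v)"

lemma depends_onD:
  "depends_on P F \<Longrightarrow> u \<in> jet_domain \<Longrightarrow> v \<in> jet_domain \<Longrightarrow> (\<And>p. p \<in> P \<Longrightarrow> u p = v p) \<Longrightarrow> F u = F v"
  unfolding depends_on_def by blast

lemma depends_on_mono: "depends_on P F \<Longrightarrow> P \<subseteq> Q \<Longrightarrow> depends_on Q F"
  unfolding depends_on_def by (meson subsetD)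

text \<open>Two kinds of coordinate sets are used: those of bounded total order, as here, and those
  of bounded order in y, for the Cauchy problem at the end.\<close>

lemma depends_up_to_iff: "depends_up_to n F \<longleftrightarrow> depends_on {p. fst p + snd p \<le> n} F"
  unfolding depends_up_to_def depends_on_def by simp

lemma depends_on_cong2:
  assumes "depends_on P F" "depends_on P G"
    and "\<And>u v. u \<in> jet_domain \<Longrightarrow> v \<in> jet_domain \<Longrightarrow> F u = F v \<Longrightarrow> G u = G v \<Longrightarrow> H u = H v"
  shows "depends_on P H"
  using assms unfolding depends_on_def by blast

lemma elem_depends: "F \<in> elem \<Longrightarrow> \<exists>n. depends_up_to n F"
proof (induction rule: elem.induct)
  case (elem_coord q)
  show ?case by (rule exI[of _ "fst q + snd q"]) (simp add: depends_up_to_iff depends_on_def del: split_paired_All)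
next
  case (elem_add F G)
  then obtain m n where "depends_up_to m F" "depends_up_to n G" by auto
  then have *: "depends_up_to (max m n) F" "depends_up_to (max m n) G"
    unfolding depends_up_to_iff by (auto elim!: depends_on_mono)
  show ?case
    unfolding depends_up_to_iff
    by (rule exI[of _ "max m n"], rule depends_on_cong2[OF *[unfolded depends_up_to_iff]]) simp
next
  case (elem_mult F G)
  then obtain m n where "depends_up_to m F" "depends_up_to n G" by auto
  then have *: "depends_up_to (max m n) F" "depends_up_to (max m n) G"
    unfolding depends_up_to_iff by (auto elim!: depends_on_mono)
  show ?case
    unfolding depends_up_to_iff
    by (rule exI[of _ "max m n"], rule depends_on_cong2[OF *[unfolded depends_up_to_iff]]) simp
next
  case (elem_powr F c)
  then obtain n where *: "depends_on {p. fst p + snd p \<le> n} F" by (auto simp: depends_up_to_iff)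
  show ?case
    unfolding depends_up_to_iff by (rule exI[of _ n], rule depends_on_cong2[OF * *]) simp
next
  case (elem_cong F G)
  then obtain n where *: "depends_on {p. fst p + snd p \<le> n} F" by (auto simp: depends_up_to_iff)
  show ?case
    unfolding depends_up_to_iff
    by (rule exI[of _ n], rule depends_on_cong2[OF * *]) (simp add: elem_cong)
qed (simp add: depends_up_to_def)

lemma elem_differential_function: "F \<in> elem \<Longrightarrow> differential_function F"
  unfolding differential_function_def by (simp add: elem_depends elem_smooth)

lemma partial_eq_0:
  assumes "depends_on P F" "p \<notin> P" "u \<in> jet_domain"
  shows "partial p F u = 0"
proof -
  have "\<forall>\<^sub>F t in nhds (u p). F (u(p := t)) = F u"
    using eventually_upd_jet_domain[OF assms(3), of p]
    by (rule eventually_mono) (use assms in \<open>auto intro: depends_onD\<close>)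
  then have "deriv (\<lambda>t. F (u(p := t))) (u p) = deriv (\<lambda>t. F u) (u p)"
    by (intro deriv_cong_ev) auto
  then show ?thesis by (simp add: partial_def)
qed

lemma finite_order_le: "finite {p :: nat \<times> nat. fst p + snd p \<le> n}"
  by (rule finite_subset[of _ "{..n} \<times> {..n}"]) auto

text \<open>A sum over an infinite set is 0 by convention; finiteness of the support makes the sums
  in \<open>Dx\<close> and \<open>Dy\<close> genuine total derivatives.\<close>

lemma finite_partial_support:
  assumes "F \<in> elem" "u \<in> jet_domain"
  shows "finite {p. partial p F u \<noteq> 0}"
proof -
  obtain n where "depends_on {p. fst p + snd p \<le> n} F"
    using elem_depends[OF assms(1)] by (auto simp: depends_up_to_iff)
  then have "{p. partial p F u \<noteq> 0} \<subseteq> {p. fst p + snd p \<le> n}"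
    using partial_eq_0[OF _ _ assms(2)] by blast
  then show ?thesis by (rule finite_subset[OF _ finite_order_le])
qed

section \<open>Total derivatives\<close>

text \<open>Treats \<open>Dx\<close> and \<open>Dy\<close> at once: \<open>\<tau>\<close> is the
  shift of the index by one differentiation.\<close>

definition total_deriv :: "(nat \<times> nat \<Rightarrow> nat \<times> nat) \<Rightarrow> (jet \<Rightarrow> real) \<Rightarrow> jet \<Rightarrow> real" where
  "total_deriv \<tau> F u = (\<Sum>p\<in>{p. partial p F u \<noteq> 0}. partial p F u * u (\<tau> p))"

lemma Dx_total_deriv: "Dx = total_deriv (\<lambda>(i, j). (i + 1, j))"
  unfolding Dx_def total_deriv_def by (simp add: fun_eq_iff case_prod_unfold)

lemma Dy_total_deriv: "Dy = total_deriv (\<lambda>(i, j). (i, j + 1))"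
  unfolding Dy_def total_deriv_def by (simp add: fun_eq_iff case_prod_unfold)

text \<open>Indices outside the support contribute zero, so the sums for several functions can be
  taken over one common finite set.\<close>

lemma total_deriv_superset:
  assumes "finite I" "\<And>p. partial p F u \<noteq> 0 \<Longrightarrow> p \<in> I"
  shows "total_deriv \<tau> F u = (\<Sum>p\<in>I. partial p F u * u (\<tau> p))"
  unfolding total_deriv_def by (rule sum.mono_neutral_left) (use assms in auto)

lemma total_deriv_cong:
  assumes "\<And>v. v \<in> jet_domain \<Longrightarrow> F v = G v" "u \<in> jet_domain"
  shows "total_deriv \<tau> F u = total_deriv \<tau> G u"
  unfolding total_deriv_def using partial_cong[OF assms] by simp

lemma total_deriv_coord: "total_deriv \<tau> (\<lambda>u. u p) u = u (\<tau> p)"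
  by (subst total_deriv_superset[of "{p}"]) (auto simp: partial_coord split: if_splits)

lemma total_deriv_const: "total_deriv \<tau> (\<lambda>u. c) u = 0"
  by (simp add: total_deriv_def partial_const)

lemma total_deriv_add:
  assumes "F \<in> elem" "G \<in> elem" "u \<in> jet_domain"
  shows "total_deriv \<tau> (\<lambda>u. F u + G u) u = total_deriv \<tau> F u + total_deriv \<tau> G u"
proof -
  define I where "I = {p. partial p F u \<noteq> 0} \<union> {p. partial p G u \<noteq> 0}"
  have I: "finite I" unfolding I_def using assms by (simp add: finite_partial_support)
  show ?thesis
    by (subst (1 2 3) total_deriv_superset[OF I])
      (use assms in \<open>auto simp: I_def partial_add sum.distrib algebra_simps\<close>)
qed

lemma total_deriv_mult:
  assumes "F \<in> elem" "G \<in> elem" "u \<in> jet_domain"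
  shows "total_deriv \<tau> (\<lambda>u. F u * G u) u = F u * total_deriv \<tau> G u + total_deriv \<tau> F u * G u"
proof -
  define I where "I = {p. partial p F u \<noteq> 0} \<union> {p. partial p G u \<noteq> 0}"
  have I: "finite I" unfolding I_def using assms by (simp add: finite_partial_support)
  show ?thesis
    by (subst (1 2 3) total_deriv_superset[OF I])
      (use assms in \<open>auto simp: I_def partial_mult sum.distrib sum_distrib_left sum_distrib_right algebra_simps\<close>)
qed

lemma total_deriv_powr:
  assumes "F \<in> elem" "\<And>u. u \<in> jet_domain \<Longrightarrow> F u > 0" "u \<in> jet_domain"
  shows "total_deriv \<tau> (\<lambda>u. F u powr c) u = c * F u powr (c - 1) * total_deriv \<tau> F u"
proof -
  define I where "I = {p. partial p F u \<noteq> 0}"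
  have I: "finite I" unfolding I_def using assms by (simp add: finite_partial_support)
  show ?thesis
    by (subst (1 2) total_deriv_superset[OF I])
      (use assms in \<open>auto simp: I_def partial_powr sum_distrib_left algebra_simps\<close>)
qed

lemma total_deriv_elem: "F \<in> elem \<Longrightarrow> total_deriv \<tau> F \<in> elem"
proof (induction rule: elem.induct)
  case (elem_coord q)
  show ?case by (rule elem_cong[OF elem.elem_coord]) (rule total_deriv_coord)
next
  case (elem_const c)
  show ?case by (rule elem_cong[OF elem.elem_const]) (rule total_deriv_const)
next
  case (elem_add F G)
  show ?case by (rule elem_cong[OF elem.elem_add]) (use elem_add in \<open>auto simp: total_deriv_add\<close>)
next
  case (elem_mult F G)
  show ?case
    by (rule elem_cong[of "\<lambda>u. F u * total_deriv \<tau> G u + total_deriv \<tau> F u * G u"])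
      (use elem_mult in \<open>auto simp: total_deriv_mult intro: elem_intros\<close>)
next
  case (elem_powr F c)
  show ?case
    by (rule elem_cong[of "\<lambda>u. c * F u powr (c - 1) * total_deriv \<tau> F u"])
      (use elem_powr in \<open>auto simp: total_deriv_powr intro!: elem_intros elem.elem_powr\<close>)
next
  case (elem_cong F G)
  show ?case
    by (rule elem.elem_cong[of "total_deriv \<tau> F"]) (use elem_cong in \<open>auto intro: total_deriv_cong\<close>)
qed

text \<open>For a coordinate this is the commutation of the two index shifts; applying the sum,
  product and power rules twice carries it through the construction of \<open>F\<close>.\<close>

lemma total_deriv_commute:
  assumes "\<And>p. \<sigma> (\<tau> p) = \<tau> (\<sigma> p)" "F \<in> elem" "u \<in> jet_domain"
  shows "total_deriv \<sigma> (total_deriv \<tau> F) u = total_deriv \<tau> (total_deriv \<sigma> F) u"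
  using assms(2,3)
proof (induction arbitrary: u rule: elem.induct)
  case (elem_coord p)
  \<comment> \<open>The inner derivative is evaluated for arbitrary shifts, so that the same fact
    rewrites both sides of the goal.\<close>
  have "total_deriv \<sigma> (total_deriv \<tau> (\<lambda>u. u p)) u = total_deriv \<sigma> (\<lambda>u. u (\<tau> p)) u" for \<sigma> \<tau>
    by (rule total_deriv_cong) (simp_all add: total_deriv_coord elem_coord)
  then show ?case by (simp add: total_deriv_coord assms(1))
next
  case (elem_const c)
  have "total_deriv \<sigma> (total_deriv \<tau> (\<lambda>u. c)) u = total_deriv \<sigma> (\<lambda>u. 0) u" for \<sigma> \<tau>
    by (rule total_deriv_cong) (simp_all add: total_deriv_const elem_const)
  then show ?case by (simp add: total_deriv_const)
next
  case (elem_add F G)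
  have "total_deriv \<sigma> (total_deriv \<tau> (\<lambda>u. F u + G u)) u =
      total_deriv \<sigma> (\<lambda>u. total_deriv \<tau> F u + total_deriv \<tau> G u) u" for \<sigma> \<tau>
    by (rule total_deriv_cong) (simp_all add: total_deriv_add elem_add)
  then show ?case using elem_add by (simp add: total_deriv_add total_deriv_elem)
next
  case (elem_mult F G)
  have "total_deriv \<sigma> (total_deriv \<tau> (\<lambda>u. F u * G u)) u =
      total_deriv \<sigma> (\<lambda>u. F u * total_deriv \<tau> G u + total_deriv \<tau> F u * G u) u" for \<sigma> \<tau>
    by (rule total_deriv_cong) (simp_all add: total_deriv_mult elem_mult)
  then show ?case using elem_mult
    by (simp add: total_deriv_add total_deriv_mult total_deriv_elem elem_intros)
next
  case (elem_powr F c)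
  have "total_deriv \<sigma> (total_deriv \<tau> (\<lambda>u. F u powr c)) u =
      total_deriv \<sigma> (\<lambda>u. c * F u powr (c - 1) * total_deriv \<tau> F u) u" for \<sigma> \<tau>
    by (rule total_deriv_cong) (simp_all add: total_deriv_powr elem_powr)
  then show ?case using elem_powr
    by (simp add: total_deriv_mult total_deriv_const total_deriv_powr total_deriv_elem
        elem_intros elem.elem_powr)
next
  case (elem_cong F G)
  have "total_deriv \<sigma> (total_deriv \<tau> G) u = total_deriv \<sigma> (total_deriv \<tau> F) u" for \<sigma> \<tau>
    by (intro total_deriv_cong elem_cong)
  then show ?case using elem_cong by simp
qed

text \<open>For \<open>p\<close> in \<open>P\<close> the two points share the coordinate
  \<open>p\<close>, so the same perturbation keeps them equal on \<open>P\<close>; for other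
  \<open>p\<close> the partial derivative vanishes.\<close>

lemma partial_depends_on:
  assumes "depends_on P F"
  shows "depends_on P (partial p F)"
proof (cases "p \<in> P")
  case True
  show ?thesis
    unfolding depends_on_def
  proof (intro ballI impI)
    fix u v assume uv: "u \<in> jet_domain" "v \<in> jet_domain" "\<forall>p\<in>P. u p = v p"
    have "\<forall>\<^sub>F t in nhds (u p). u(p := t) \<in> jet_domain \<and> v(p := t) \<in> jet_domain"
      using eventually_upd_jet_domain[OF uv(1), of p] eventually_upd_jet_domain[OF uv(2), of p]
      by (simp add: eventually_conj_iff uv(3) True)
    then have "\<forall>\<^sub>F t in nhds (u p). F (u(p := t)) = F (v(p := t))"
      by (rule eventually_mono) (use uv in \<open>auto intro: depends_onD[OF assms]\<close>)
    then show "partial p F u = partial p F v"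
      unfolding partial_def using uv(3) True by (intro deriv_cong_ev) auto
  qed
next
  case False
  then show ?thesis using partial_eq_0[OF assms] by (simp add: depends_on_def)
qed

lemma total_deriv_depends_on:
  assumes "depends_on P F" "P \<subseteq> Q" "\<tau> ` P \<subseteq> Q"
  shows "depends_on Q (total_deriv \<tau> F)"
  unfolding depends_on_def
proof (intro ballI impI)
  fix u v assume uv: "u \<in> jet_domain" "v \<in> jet_domain" "\<forall>p\<in>Q. u p = v p"
  have eq: "partial p F u = partial p F v" for p
    using uv assms by (intro depends_onD[OF partial_depends_on[OF assms(1)]]) auto
  show "total_deriv \<tau> F u = total_deriv \<tau> F v"
    unfolding total_deriv_def eq
  proof (rule sum.cong)
    fix p assume "p \<in> {p. partial p F v \<noteq> 0}"
    then have "p \<in> P" using partial_eq_0[OF assms(1) _ uv(2)] by (metis mem_Collect_eq)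
    then show "partial p F v * u (\<tau> p) = partial p F v * v (\<tau> p)" using assms uv by auto
  qed simp
qed

section \<open>Calculus of the total derivatives in x and y\<close>

lemma Dx_elem: "F \<in> elem \<Longrightarrow> Dx F \<in> elem"
  and Dy_elem: "F \<in> elem \<Longrightarrow> Dy F \<in> elem"
  by (simp_all add: Dx_total_deriv Dy_total_deriv total_deriv_elem)

lemma Dx_cong: "(\<And>v. v \<in> jet_domain \<Longrightarrow> F v = G v) \<Longrightarrow> u \<in> jet_domain \<Longrightarrow> Dx F u = Dx G u"
  and Dy_cong: "(\<And>v. v \<in> jet_domain \<Longrightarrow> F v = G v) \<Longrightarrow> u \<in> jet_domain \<Longrightarrow> Dy F u = Dy G u"
  unfolding Dx_total_deriv Dy_total_deriv by (rule total_deriv_cong; simp)+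

lemma Dx_Dy_commute: "F \<in> elem \<Longrightarrow> u \<in> jet_domain \<Longrightarrow> Dx (Dy F) u = Dy (Dx F) u"
  unfolding Dx_total_deriv Dy_total_deriv by (rule total_deriv_commute) auto

lemma Dx_coord: "Dx (\<lambda>u. u (i, j)) u = u (i + 1, j)"
  and Dy_coord: "Dy (\<lambda>u. u (i, j)) u = u (i, j + 1)"
  by (simp_all add: Dx_total_deriv Dy_total_deriv total_deriv_coord)

lemma Dx_const: "Dx (\<lambda>u. c) u = 0"
  and Dy_const: "Dy (\<lambda>u. c) u = 0"
  by (simp_all add: Dx_total_deriv Dy_total_deriv total_deriv_const)

lemma Dx_add: "F \<in> elem \<Longrightarrow> G \<in> elem \<Longrightarrow> u \<in> jet_domain \<Longrightarrow>
    Dx (\<lambda>u. F u + G u) u = Dx F u + Dx G u"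
  and Dy_add: "F \<in> elem \<Longrightarrow> G \<in> elem \<Longrightarrow> u \<in> jet_domain \<Longrightarrow>
    Dy (\<lambda>u. F u + G u) u = Dy F u + Dy G u"
  by (simp_all add: Dx_total_deriv Dy_total_deriv total_deriv_add)

lemma Dx_mult: "F \<in> elem \<Longrightarrow> G \<in> elem \<Longrightarrow> u \<in> jet_domain \<Longrightarrow>
    Dx (\<lambda>u. F u * G u) u = F u * Dx G u + Dx F u * G u"
  and Dy_mult: "F \<in> elem \<Longrightarrow> G \<in> elem \<Longrightarrow> u \<in> jet_domain \<Longrightarrow>
    Dy (\<lambda>u. F u * G u) u = F u * Dy G u + Dy F u * G u"
  by (simp_all add: Dx_total_deriv Dy_total_deriv total_deriv_mult)

lemma Dx_minus: "F \<in> elem \<Longrightarrow> u \<in> jet_domain \<Longrightarrow> Dx (\<lambda>u. - F u) u = - Dx F u"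
  and Dy_minus: "F \<in> elem \<Longrightarrow> u \<in> jet_domain \<Longrightarrow> Dy (\<lambda>u. - F u) u = - Dy F u"
  using Dx_mult[of "\<lambda>u. - 1" F u] Dy_mult[of "\<lambda>u. - 1" F u]
  by (simp_all add: elem_const Dx_const Dy_const)

lemma Dx_diff: "F \<in> elem \<Longrightarrow> G \<in> elem \<Longrightarrow> u \<in> jet_domain \<Longrightarrow>
    Dx (\<lambda>u. F u - G u) u = Dx F u - Dx G u"
  and Dy_diff: "F \<in> elem \<Longrightarrow> G \<in> elem \<Longrightarrow> u \<in> jet_domain \<Longrightarrow>
    Dy (\<lambda>u. F u - G u) u = Dy F u - Dy G u"
  using Dx_add[of F "\<lambda>u. - G u" u] Dy_add[of F "\<lambda>u. - G u" u]
  by (simp_all add: elem_minus Dx_minus Dy_minus)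

lemma Dx_power: "F \<in> elem \<Longrightarrow> u \<in> jet_domain \<Longrightarrow>
    Dx (\<lambda>u. F u ^ n) u = of_nat n * F u ^ (n - 1) * Dx F u"
  and Dy_power: "F \<in> elem \<Longrightarrow> u \<in> jet_domain \<Longrightarrow>
    Dy (\<lambda>u. F u ^ n) u = of_nat n * F u ^ (n - 1) * Dy F u"
proof -
  show "Dx (\<lambda>u. F u ^ n) u = of_nat n * F u ^ (n - 1) * Dx F u"
    if "F \<in> elem" "u \<in> jet_domain" using that
  proof (induction n)
    case (Suc n)
    then show ?case
      by (cases n) (simp_all add: Dx_mult elem_power elem_mult Dx_const elem_const algebra_simps)
  qed (simp add: Dx_const)
  show "Dy (\<lambda>u. F u ^ n) u = of_nat n * F u ^ (n - 1) * Dy F u"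
    if "F \<in> elem" "u \<in> jet_domain" using that
  proof (induction n)
    case (Suc n)
    then show ?case
      by (cases n) (simp_all add: Dy_mult elem_power elem_mult Dy_const elem_const algebra_simps)
  qed (simp add: Dy_const)
qed

lemma Dx_divide_const: "F \<in> elem \<Longrightarrow> u \<in> jet_domain \<Longrightarrow> Dx (\<lambda>u. F u / c) u = Dx F u / c"
  and Dy_divide_const: "F \<in> elem \<Longrightarrow> u \<in> jet_domain \<Longrightarrow> Dy (\<lambda>u. F u / c) u = Dy F u / c"
  unfolding divide_inverse by (simp_all add: Dx_mult Dy_mult Dx_const Dy_const elem_const)

lemmas D_rules = Dx_divide_const Dy_divide_const Dx_coord Dx_const Dx_add Dx_mult Dx_minus Dx_diff Dx_power
  Dy_coord Dy_const Dy_add Dy_mult Dy_minus Dy_diff Dy_power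

lemma funpow_D_elem: "F \<in> elem \<Longrightarrow> (Dx ^^ i) ((Dy ^^ j) F) \<in> elem"
proof -
  assume "F \<in> elem"
  then have "(Dy ^^ j) F \<in> elem" by (induction j) (auto intro: Dy_elem)
  then show ?thesis by (induction i) (auto intro: Dx_elem)
qed

text \<open>The prolonged equation is written with every \<open>Dx\<close> outside every
  \<open>Dy\<close>; a further \<open>Dy\<close> is moved inwards to restore that form.\<close>

lemma Dy_funpow_D:
  assumes "F \<in> elem" "u \<in> jet_domain"
  shows "Dy ((Dx ^^ i) ((Dy ^^ j) F)) u = (Dx ^^ i) ((Dy ^^ Suc j) F) u"
  using assms(2)
proof (induction i arbitrary: u)
  case (Suc i)
  have "Dy (Dx ((Dx ^^ i) ((Dy ^^ j) F))) u = Dx (Dy ((Dx ^^ i) ((Dy ^^ j) F))) u"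
    using Dx_Dy_commute funpow_D_elem assms(1) Suc.prems by metis
  also have "\<dots> = Dx ((Dx ^^ i) ((Dy ^^ Suc j) F)) u"
    by (rule Dx_cong) (use Suc in auto)
  finally show ?case by simp
qed simp

section \<open>The reciprocal of z and the equation in explicit form\<close>

definition inv_z :: "jet \<Rightarrow> real" where "inv_z u = 1 / u (0, 0)"

lemma z_pos: "u \<in> jet_domain \<Longrightarrow> u (0, 0) > 0"
  by (simp add: jet_domain_def)

lemma inv_z_elem: "inv_z \<in> elem"
  unfolding inv_z_def by (intro elem_divide elem_intros z_pos)

lemma inv_z_mult: "u \<in> jet_domain \<Longrightarrow> inv_z u * u (0, 0) = 1"
  using z_pos[of u] by (simp add: inv_z_def)

text \<open>Obtained by differentiating the relation that characterizes the function, here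
  \<open>inv_z u * u (0, 0) = 1\<close>. The same device yields the derivatives of
  \<open>rho\<close>, \<open>irho\<close>, \<open>Cm\<close> and \<open>iCm\<close>.\<close>

lemma Dx_inv_z: "u \<in> jet_domain \<Longrightarrow> Dx inv_z u = - (inv_z u)\<^sup>2 * u (1, 0)"
  and Dy_inv_z: "u \<in> jet_domain \<Longrightarrow> Dy inv_z u = - (inv_z u)\<^sup>2 * u (0, 1)"
proof -
  assume u: "u \<in> jet_domain"
  have 1: "0 = inv_z u * u (1, 0) + Dx inv_z u * u (0, 0)"
    using Dx_cong[of "\<lambda>u. inv_z u * u (0, 0)" "\<lambda>u. 1", OF inv_z_mult u] u
    by (simp add: D_rules inv_z_elem elem_intros)
  have 2: "0 = inv_z u * u (0, 1) + Dy inv_z u * u (0, 0)"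
    using Dy_cong[of "\<lambda>u. inv_z u * u (0, 0)" "\<lambda>u. 1", OF inv_z_mult u] u
    by (simp add: D_rules inv_z_elem elem_intros)
  show "Dx inv_z u = - (inv_z u)\<^sup>2 * u (1, 0)" "Dy inv_z u = - (inv_z u)\<^sup>2 * u (0, 1)"
    using 1 2 inv_z_mult[OF u] by algebra+
qed

lemma Dx_Dx_inv_z: "u \<in> jet_domain \<Longrightarrow>
    Dx (Dx inv_z) u = 2 * (inv_z u) ^ 3 * (u (1, 0))\<^sup>2 - (inv_z u)\<^sup>2 * u (2, 0)"
  by (subst Dx_cong[OF Dx_inv_z], assumption+)
    (simp add: D_rules Dx_inv_z inv_z_elem elem_intros algebra_simps power2_eq_square power3_eq_cube numeral_2_eq_2)

lemma cae_eq_inv_z: "cae u = u (0, 2) + Dx (Dx inv_z) u + 2"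
  by (simp add: cae_def inv_z_def[abs_def])

lemma cae_explicit: "u \<in> jet_domain \<Longrightarrow>
    cae u = u (0, 2) + (2 * (inv_z u) ^ 3 * (u (1, 0))\<^sup>2 - (inv_z u)\<^sup>2 * u (2, 0)) + 2"
  by (simp add: cae_eq_inv_z Dx_Dx_inv_z)

lemma cae_elem: "cae \<in> elem"
  unfolding cae_eq_inv_z[abs_def] by (intro elem_intros Dx_elem inv_z_elem)

section \<open>Congruence modulo the equation\<close>

text \<open>The differential ideal generated by the equation over the elementary functions. That a
  function vanishes on \<open>cae_jets\<close> does not visibly pass to its total derivatives, since
  jets there cannot be varied freely; membership in the ideal does pass, by the Leibniz
  rule.\<close>

inductive_set cae_ideal :: "(jet \<Rightarrow> real) set" where
  gen: "(Dx ^^ i) ((Dy ^^ j) cae) \<in> cae_ideal"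
| add: "F \<in> cae_ideal \<Longrightarrow> G \<in> cae_ideal \<Longrightarrow> (\<lambda>u. F u + G u) \<in> cae_ideal"
| mult: "G \<in> elem \<Longrightarrow> F \<in> cae_ideal \<Longrightarrow> (\<lambda>u. G u * F u) \<in> cae_ideal"
| cong: "F \<in> cae_ideal \<Longrightarrow> (\<And>u. u \<in> jet_domain \<Longrightarrow> G u = F u) \<Longrightarrow> G \<in> cae_ideal"

lemma cae_ideal_cae: "cae \<in> cae_ideal"
  using cae_ideal.gen[of 0 0] by simp

lemma cae_ideal_elem: "F \<in> cae_ideal \<Longrightarrow> F \<in> elem"
proof (induction rule: cae_ideal.induct)
  case (cong F G)
  then show ?case by (blast intro: elem_cong)
qed (simp_all add: funpow_D_elem cae_elem elem_intros)

lemma cae_ideal_eq_0: "F \<in> cae_ideal \<Longrightarrow> u \<in> cae_jets \<Longrightarrow> F u = 0"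
  by (induction rule: cae_ideal.induct) (auto simp: cae_jets_def)

lemma cae_ideal_Dx: "F \<in> cae_ideal \<Longrightarrow> Dx F \<in> cae_ideal"
proof (induction rule: cae_ideal.induct)
  case (gen i j)
  show ?case using cae_ideal.gen[of "Suc i" j] by simp
next
  case (add F G)
  show ?case
    by (rule cae_ideal.cong[OF cae_ideal.add[of "Dx F" "Dx G"]])
      (use add in \<open>auto simp: Dx_add cae_ideal_elem\<close>)
next
  case (mult G F)
  show ?case
    by (rule cae_ideal.cong[OF cae_ideal.add[OF cae_ideal.mult[of G "Dx F"] cae_ideal.mult[of "Dx G" F]]])
      (use mult in \<open>auto simp: Dx_mult cae_ideal_elem Dx_elem\<close>)
next
  case (cong F G)
  show ?case by (rule cae_ideal.cong[of "Dx F"]) (use cong in \<open>auto intro: Dx_cong\<close>)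
qed

lemma cae_ideal_Dy: "F \<in> cae_ideal \<Longrightarrow> Dy F \<in> cae_ideal"
proof (induction rule: cae_ideal.induct)
  case (gen i j)
  show ?case
    by (rule cae_ideal.cong[OF cae_ideal.gen[of i "Suc j"]]) (rule Dy_funpow_D[OF cae_elem])
next
  case (add F G)
  show ?case
    by (rule cae_ideal.cong[OF cae_ideal.add[of "Dy F" "Dy G"]])
      (use add in \<open>auto simp: Dy_add cae_ideal_elem\<close>)
next
  case (mult G F)
  show ?case
    by (rule cae_ideal.cong[OF cae_ideal.add[OF cae_ideal.mult[of G "Dy F"] cae_ideal.mult[of "Dy G" F]]])
      (use mult in \<open>auto simp: Dy_mult cae_ideal_elem Dy_elem\<close>)
next
  case (cong F G)
  show ?case by (rule cae_ideal.cong[of "Dy F"]) (use cong in \<open>auto intro: Dy_cong\<close>)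
qed

section \<open>On-shell equality as a congruence compatible with total derivatives\<close>

definition on_shell_eq :: "(jet \<Rightarrow> real) \<Rightarrow> (jet \<Rightarrow> real) \<Rightarrow> bool" (infix "\<doteq>" 50) where
  "F \<doteq> G \<longleftrightarrow> F \<in> elem \<and> G \<in> elem \<and> (\<lambda>u. F u - G u) \<in> cae_ideal"

lemma on_shell_eq_elem: "F \<doteq> G \<Longrightarrow> F \<in> elem" "F \<doteq> G \<Longrightarrow> G \<in> elem"
  by (simp_all add: on_shell_eq_def)

lemma on_shell_eq_eq: "F \<doteq> G \<Longrightarrow> u \<in> cae_jets \<Longrightarrow> F u = G u"
  using cae_ideal_eq_0[of "\<lambda>u. F u - G u" u] by (simp add: on_shell_eq_def)

text \<open>The source of all on-shell equalities: \<open>M = 0\<close> gives identities valid on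
  the whole domain, and a constant \<open>M\<close> brings in the equation itself.\<close>

lemma on_shell_eqI:
  assumes "F \<in> elem" "M \<in> elem" "\<And>u. u \<in> jet_domain \<Longrightarrow> F u = G u + M u * cae u"
  shows "F \<doteq> G"
proof -
  have "G \<in> elem"
    by (rule elem_cong[of "\<lambda>u. F u - M u * cae u"]) (use assms cae_elem in \<open>auto intro: elem_intros\<close>)
  moreover have "(\<lambda>u. F u - G u) \<in> cae_ideal"
    by (rule cae_ideal.cong[OF cae_ideal.mult[OF assms(2) cae_ideal_cae]]) (simp add: assms(3))
  ultimately show ?thesis using assms(1) by (simp add: on_shell_eq_def)
qed

lemma on_shell_eq_dom: "F \<in> elem \<Longrightarrow> (\<And>u. u \<in> jet_domain \<Longrightarrow> F u = G u) \<Longrightarrow> F \<doteq> G"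
  by (rule on_shell_eqI[of _ "\<lambda>u. 0"]) (auto intro: elem_const)

lemma on_shell_eq_refl: "F \<in> elem \<Longrightarrow> F \<doteq> F"
  by (rule on_shell_eq_dom) auto

lemma on_shell_eq_sym: "F \<doteq> G \<Longrightarrow> G \<doteq> F"
  using cae_ideal.cong[OF cae_ideal.mult[of "\<lambda>u. - 1" "\<lambda>u. F u - G u"], of "\<lambda>u. G u - F u"]
  by (auto simp: on_shell_eq_def elem_const)

lemma on_shell_eq_trans [trans]: "F \<doteq> G \<Longrightarrow> G \<doteq> H \<Longrightarrow> F \<doteq> H"
  using cae_ideal.cong[OF cae_ideal.add[of "\<lambda>u. F u - G u" "\<lambda>u. G u - H u"], of "\<lambda>u. F u - H u"]
  by (auto simp: on_shell_eq_def)

lemma on_shell_eq_add: "F \<doteq> F' \<Longrightarrow> G \<doteq> G' \<Longrightarrow> (\<lambda>u. F u + G u) \<doteq> (\<lambda>u. F' u + G' u)"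
  using cae_ideal.cong[OF cae_ideal.add[of "\<lambda>u. F u - F' u" "\<lambda>u. G u - G' u"],
      of "\<lambda>u. (F u + G u) - (F' u + G' u)"]
  by (auto simp: on_shell_eq_def elem_add)

lemma on_shell_eq_mult: "F \<doteq> F' \<Longrightarrow> G \<doteq> G' \<Longrightarrow> (\<lambda>u. F u * G u) \<doteq> (\<lambda>u. F' u * G' u)"
  using cae_ideal.cong[OF cae_ideal.add[OF cae_ideal.mult[of G "\<lambda>u. F u - F' u"]
        cae_ideal.mult[of F' "\<lambda>u. G u - G' u"]], of "\<lambda>u. F u * G u - F' u * G' u"]
  by (auto simp: on_shell_eq_def elem_mult algebra_simps)

lemma on_shell_eq_minus: "F \<doteq> F' \<Longrightarrow> (\<lambda>u. - F u) \<doteq> (\<lambda>u. - F' u)"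
  using on_shell_eq_mult[OF on_shell_eq_refl[OF elem_const[of "-1"]], of F F'] by simp

lemma on_shell_eq_diff: "F \<doteq> F' \<Longrightarrow> G \<doteq> G' \<Longrightarrow> (\<lambda>u. F u - G u) \<doteq> (\<lambda>u. F' u - G' u)"
  using on_shell_eq_add[OF _ on_shell_eq_minus, of F F' G G'] by simp

lemma on_shell_eq_power: "F \<doteq> F' \<Longrightarrow> (\<lambda>u. F u ^ n) \<doteq> (\<lambda>u. F' u ^ n)"
proof (induction n)
  case (Suc n)
  then show ?case using on_shell_eq_mult by simp
qed (simp add: on_shell_eq_refl elem_const)

lemma on_shell_eq_Dx: "F \<doteq> G \<Longrightarrow> Dx F \<doteq> Dx G"
  and on_shell_eq_Dy: "F \<doteq> G \<Longrightarrow> Dy F \<doteq> Dy G"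
proof -
  assume *: "F \<doteq> G"
  then have e: "F \<in> elem" "G \<in> elem" by (auto dest: on_shell_eq_elem)
  have "(\<lambda>u. Dx F u - Dx G u) \<in> cae_ideal" "(\<lambda>u. Dy F u - Dy G u) \<in> cae_ideal"
    using * cae_ideal.cong[OF cae_ideal_Dx[of "\<lambda>u. F u - G u"], of "\<lambda>u. Dx F u - Dx G u"]
      cae_ideal.cong[OF cae_ideal_Dy[of "\<lambda>u. F u - G u"], of "\<lambda>u. Dy F u - Dy G u"]
    by (auto simp: on_shell_eq_def Dx_diff Dy_diff)
  then show "Dx F \<doteq> Dx G" "Dy F \<doteq> Dy G"
    using e by (auto simp: on_shell_eq_def Dx_elem Dy_elem)
qed

section \<open>Characteristic variables\<close>

(* rho, irho, Sm, Sp, Cm, iCm, w1 are s, 1/s, S, T, C, 1/C, w of the introduction. *)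
definition rho :: "jet \<Rightarrow> real" where "rho u = sqrt (u (0, 0))"
definition irho :: "jet \<Rightarrow> real" where "irho u = 1 / rho u"

definition Yp :: "(jet \<Rightarrow> real) \<Rightarrow> jet \<Rightarrow> real" where
  "Yp F u = irho u * (Dx F u + u (0, 0) * Dy F u)"
definition Ym :: "(jet \<Rightarrow> real) \<Rightarrow> jet \<Rightarrow> real" where
  "Ym F u = irho u * (Dx F u - u (0, 0) * Dy F u)"

definition Sp :: "jet \<Rightarrow> real" where
  "Sp u = irho u ^ 3 / 2 * (u (1, 0) + u (0, 0) * u (0, 1))"
definition Sm :: "jet \<Rightarrow> real" where
  "Sm u = irho u ^ 3 / 2 * (u (1, 0) - u (0, 0) * u (0, 1))"

section \<open>The root of z, the characteristic derivations and their commutator\<close>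

lemma rho_sq: "u \<in> jet_domain \<Longrightarrow> rho u * rho u = u (0, 0)"
  using z_pos[of u] by (simp add: rho_def)

lemma rho_pos: "u \<in> jet_domain \<Longrightarrow> rho u > 0"
  using z_pos[of u] by (simp add: rho_def)

lemma irho_rho: "u \<in> jet_domain \<Longrightarrow> irho u * rho u = 1"
  using rho_pos[of u] by (simp add: irho_def)

lemma rho_elem: "rho \<in> elem"
  unfolding rho_def by (intro elem_sqrt elem_intros z_pos)

lemma irho_elem: "irho \<in> elem"
  unfolding irho_def by (intro elem_divide elem_intros rho_elem rho_pos)

lemma inv_z_irho: "u \<in> jet_domain \<Longrightarrow> inv_z u = irho u * irho u"
  using rho_sq[of u] by (simp add: irho_def inv_z_def)

lemma D_rho:
  assumes u: "u \<in> jet_domain"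
  shows "Dx rho u = irho u / 2 * u (1, 0)" "Dy rho u = irho u / 2 * u (0, 1)"
proof -
  have "Dx (\<lambda>u. rho u * rho u) u = Dx (\<lambda>u. u (0, 0)) u"
    "Dy (\<lambda>u. rho u * rho u) u = Dy (\<lambda>u. u (0, 0)) u"
    by (rule Dx_cong, erule rho_sq, rule u, rule Dy_cong, erule rho_sq, rule u)
  then have "2 * rho u * Dx rho u = u (1, 0)" "2 * rho u * Dy rho u = u (0, 1)"
    using u by (simp_all add: D_rules rho_elem)
  then show "Dx rho u = irho u / 2 * u (1, 0)" "Dy rho u = irho u / 2 * u (0, 1)"
    using rho_pos[OF u] by (simp_all add: irho_def field_simps)
qed

lemma D_irho:
  assumes u: "u \<in> jet_domain"
  shows "Dx irho u = - (irho u ^ 3) / 2 * u (1, 0)" "Dy irho u = - (irho u ^ 3) / 2 * u (0, 1)"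
proof -
  have "Dx (\<lambda>u. irho u * rho u) u = Dx (\<lambda>u. 1) u"
    "Dy (\<lambda>u. irho u * rho u) u = Dy (\<lambda>u. 1) u"
    by (rule Dx_cong, erule irho_rho, rule u, rule Dy_cong, erule irho_rho, rule u)
  then have "irho u * irho u * u (1, 0) + 2 * Dx irho u * rho u = 0"
    "irho u * irho u * u (0, 1) + 2 * Dy irho u * rho u = 0"
    using u by (simp_all add: D_rules rho_elem irho_elem D_rho)
  then have "2 * Dx irho u = - (irho u ^ 3) * u (1, 0)" "2 * Dy irho u = - (irho u ^ 3) * u (0, 1)"
    using irho_rho[OF u] by algebra+
  then show "Dx irho u = - (irho u ^ 3) / 2 * u (1, 0)" "Dy irho u = - (irho u ^ 3) / 2 * u (0, 1)"
    by simp_all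
qed

lemma Y_elem: "F \<in> elem \<Longrightarrow> Yp F \<in> elem" "F \<in> elem \<Longrightarrow> Ym F \<in> elem"
  unfolding Yp_def Ym_def by (auto intro!: elem_intros irho_elem Dx_elem Dy_elem)

lemma Sp_elem: "Sp \<in> elem" and Sm_elem: "Sm \<in> elem"
  unfolding Sp_def Sm_def by (auto intro!: elem_intros irho_elem elem_divide)

lemma Y_const: "Yp (\<lambda>u. c) u = 0" "Ym (\<lambda>u. c) u = 0"
  by (simp_all add: Yp_def Ym_def D_rules)

lemma Y_mult:
  assumes "F \<in> elem" "G \<in> elem" "u \<in> jet_domain"
  shows "Yp (\<lambda>u. F u * G u) u = F u * Yp G u + Yp F u * G u"
    "Ym (\<lambda>u. F u * G u) u = F u * Ym G u + Ym F u * G u"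
  using assms by (simp_all add: Yp_def Ym_def D_rules algebra_simps)

lemma Y_add:
  assumes "F \<in> elem" "G \<in> elem" "u \<in> jet_domain"
  shows "Yp (\<lambda>u. F u + G u) u = Yp F u + Yp G u"
    "Ym (\<lambda>u. F u + G u) u = Ym F u + Ym G u"
  using assms by (simp_all add: Yp_def Ym_def D_rules algebra_simps)

lemma D_eq_Y:
  assumes "u \<in> jet_domain"
  shows "Dx F u = rho u / 2 * (Yp F u + Ym F u)" "Dy F u = irho u / 2 * (Yp F u - Ym F u)"
proof -
  have "rho u * irho u = 1" "u (0, 0) * irho u * irho u = 1"
    using irho_rho[OF assms] rho_sq[OF assms] by algebra+
  then show "Dx F u = rho u / 2 * (Yp F u + Ym F u)" "Dy F u = irho u / 2 * (Yp F u - Ym F u)"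
    unfolding Yp_def Ym_def by algebra+
qed

text \<open>Second derivatives of \<open>F\<close> cancel because \<open>Dx\<close> and
  \<open>Dy\<close> commute. What remains comes from differentiating the coefficients
  \<open>irho\<close> and z, and regroups into \<open>Sp\<close> and \<open>Sm\<close>.\<close>

lemma Y_commutator:
  assumes F: "F \<in> elem" and u: "u \<in> jet_domain"
  shows "Yp (Ym F) u = Ym (Yp F) u - Sp u * Yp F u + Sm u * Ym F u"
proof -
  note e = irho_elem Dx_elem[OF F] Dy_elem[OF F] elem_intros
  have "Dx (Ym F) u = irho u * (Dx (Dx F) u - (u (0, 0) * Dx (Dy F) u + u (1, 0) * Dy F u))
      + Dx irho u * (Dx F u - u (0, 0) * Dy F u)"
    "Dy (Ym F) u = irho u * (Dx (Dy F) u - (u (0, 0) * Dy (Dy F) u + u (0, 1) * Dy F u))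
      + Dy irho u * (Dx F u - u (0, 0) * Dy F u)"
    "Dx (Yp F) u = irho u * (Dx (Dx F) u + (u (0, 0) * Dx (Dy F) u + u (1, 0) * Dy F u))
      + Dx irho u * (Dx F u + u (0, 0) * Dy F u)"
    "Dy (Yp F) u = irho u * (Dx (Dy F) u + (u (0, 0) * Dy (Dy F) u + u (0, 1) * Dy F u))
      + Dy irho u * (Dx F u + u (0, 0) * Dy F u)"
    unfolding Yp_def[abs_def] Ym_def[abs_def] using u Dx_Dy_commute[OF F u]
    by (simp_all add: D_rules e)
  then show ?thesis
    unfolding Yp_def[of "Ym F"] Ym_def[of "Yp F"] unfolding Yp_def Ym_def Sp_def Sm_def D_irho[OF u]
    using irho_rho[OF u] rho_sq[OF u]
    by (simp add: field_simps) algebra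
qed

(* [has_Y F P M]: on the equation, the derivations Yp, Ym send F to P, M. The rules below
   then differentiate terms in the manner of derivative_intros. *)
definition has_Y :: "(jet \<Rightarrow> real) \<Rightarrow> (jet \<Rightarrow> real) \<Rightarrow> (jet \<Rightarrow> real) \<Rightarrow> bool" where
  "has_Y F P M \<longleftrightarrow> F \<in> elem \<and> Yp F \<doteq> P \<and> Ym F \<doteq> M"

section \<open>Rules for characteristic derivatives on the equation\<close>

lemma has_YD: "has_Y F P M \<Longrightarrow> F \<in> elem" "has_Y F P M \<Longrightarrow> P \<in> elem" "has_Y F P M \<Longrightarrow> M \<in> elem"
  "has_Y F P M \<Longrightarrow> Yp F \<doteq> P" "has_Y F P M \<Longrightarrow> Ym F \<doteq> M"
  by (auto simp: has_Y_def dest: on_shell_eq_elem)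

lemma has_Y_eq:
  assumes "has_Y F P M" "\<And>u. u \<in> jet_domain \<Longrightarrow> P u = P' u" "\<And>u. u \<in> jet_domain \<Longrightarrow> M u = M' u"
  shows "has_Y F P' M'"
proof -
  have "P \<doteq> P'" "M \<doteq> M'"
    using has_YD(2,3)[OF assms(1)] assms(2,3) by (auto intro: on_shell_eq_dom)
  then show ?thesis using assms(1) on_shell_eq_trans unfolding has_Y_def by blast
qed

lemma on_shell_eq_Y: "F \<doteq> G \<Longrightarrow> Yp F \<doteq> Yp G" "F \<doteq> G \<Longrightarrow> Ym F \<doteq> Ym G"
  unfolding Yp_def[abs_def] Ym_def[abs_def]
  by (intro on_shell_eq_mult on_shell_eq_add on_shell_eq_diff on_shell_eq_Dx on_shell_eq_Dy
      on_shell_eq_refl irho_elem elem_intros; assumption)+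

lemma has_Y_const: "has_Y (\<lambda>u. c) (\<lambda>u. 0) (\<lambda>u. 0)"
  unfolding has_Y_def
  by (intro conjI on_shell_eq_dom) (auto simp: Y_const intro: elem_intros Y_elem)

lemma has_Y_mult:
  assumes "has_Y F P M" "has_Y G P' M'"
  shows "has_Y (\<lambda>u. F u * G u) (\<lambda>u. F u * P' u + P u * G u) (\<lambda>u. F u * M' u + M u * G u)"
proof -
  have e: "F \<in> elem" "G \<in> elem" using assms has_YD by auto
  have "Yp (\<lambda>u. F u * G u) \<doteq> (\<lambda>u. F u * Yp G u + Yp F u * G u)"
    "Ym (\<lambda>u. F u * G u) \<doteq> (\<lambda>u. F u * Ym G u + Ym F u * G u)"
    using e by (auto intro!: on_shell_eq_dom Y_elem elem_intros simp: Y_mult)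
  moreover have "(\<lambda>u. F u * Yp G u + Yp F u * G u) \<doteq> (\<lambda>u. F u * P' u + P u * G u)"
    "(\<lambda>u. F u * Ym G u + Ym F u * G u) \<doteq> (\<lambda>u. F u * M' u + M u * G u)"
    using e assms by (auto intro!: on_shell_eq_mult on_shell_eq_add on_shell_eq_refl dest: has_YD)
  ultimately show ?thesis
    using e by (auto simp: has_Y_def intro: elem_intros on_shell_eq_trans)
qed

lemma has_Y_add:
  assumes "has_Y F P M" "has_Y G P' M'"
  shows "has_Y (\<lambda>u. F u + G u) (\<lambda>u. P u + P' u) (\<lambda>u. M u + M' u)"
proof -
  have e: "F \<in> elem" "G \<in> elem" using assms has_YD by auto
  have "Yp (\<lambda>u. F u + G u) \<doteq> (\<lambda>u. Yp F u + Yp G u)"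
    "Ym (\<lambda>u. F u + G u) \<doteq> (\<lambda>u. Ym F u + Ym G u)"
    using e by (auto intro!: on_shell_eq_dom Y_elem elem_intros simp: Y_add)
  moreover have "(\<lambda>u. Yp F u + Yp G u) \<doteq> (\<lambda>u. P u + P' u)"
    "(\<lambda>u. Ym F u + Ym G u) \<doteq> (\<lambda>u. M u + M' u)"
    using assms by (auto intro!: on_shell_eq_add dest: has_YD)
  ultimately show ?thesis
    using e by (auto simp: has_Y_def intro: elem_intros on_shell_eq_trans)
qed

lemma has_Y_minus: "has_Y F P M \<Longrightarrow> has_Y (\<lambda>u. - F u) (\<lambda>u. - P u) (\<lambda>u. - M u)"
  using has_Y_mult[OF has_Y_const[of "-1"], of F P M] by simp

lemma has_Y_diff:
  "has_Y F P M \<Longrightarrow> has_Y G P' M' \<Longrightarrow> has_Y (\<lambda>u. F u - G u) (\<lambda>u. P u - P' u) (\<lambda>u. M u - M' u)"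
  using has_Y_add[OF _ has_Y_minus, of F P M G P' M'] by simp

lemma has_Y_power:
  assumes "has_Y F P M"
  shows "has_Y (\<lambda>u. F u ^ n) (\<lambda>u. real n * F u ^ (n - 1) * P u) (\<lambda>u. real n * F u ^ (n - 1) * M u)"
proof (induction n)
  case (Suc n)
  show ?case
    using has_Y_eq[OF has_Y_mult[OF assms Suc]]
    by (cases n) (simp_all add: algebra_simps)
qed (simp add: has_Y_const)

lemma has_Y_divide_const: "has_Y F P M \<Longrightarrow> has_Y (\<lambda>u. F u / c) (\<lambda>u. P u / c) (\<lambda>u. M u / c)"
  using has_Y_mult[OF _ has_Y_const[of "inverse c"], of F P M] by (simp add: divide_inverse)

text \<open>Climbs one order in the \<open>Ym\<close> direction: the commutator gives
  \<open>Yp M\<close> from known data, while \<open>Ym M\<close> enters as a new independent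
  variable. \<open>has_Y_Yp\<close> is the mirror image.\<close>

lemma has_Y_Ym:
  assumes "has_Y F P M" "has_Y P PP PM"
  shows "has_Y M (\<lambda>u. PM u - Sp u * P u + Sm u * M u) (Ym M)"
proof -
  have F: "F \<in> elem" and M: "M \<in> elem" using assms has_YD by auto
  have "Yp M \<doteq> Yp (Ym F)"
    by (rule on_shell_eq_Y(1)[OF on_shell_eq_sym[OF has_YD(5)[OF assms(1)]]])
  also have "\<dots> \<doteq> (\<lambda>u. Ym (Yp F) u - Sp u * Yp F u + Sm u * Ym F u)"
    using F by (intro on_shell_eq_dom Y_commutator Y_elem)
  also have "\<dots> \<doteq> (\<lambda>u. PM u - Sp u * P u + Sm u * M u)"
    by (intro on_shell_eq_add on_shell_eq_diff on_shell_eq_mult on_shell_eq_refl[OF Sp_elem]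
        on_shell_eq_refl[OF Sm_elem] on_shell_eq_trans[OF on_shell_eq_Y(2) has_YD(5)[OF assms(2)]]
        has_YD(4,5)[OF assms(1)])
  finally show ?thesis using M by (auto simp: has_Y_def intro: on_shell_eq_refl Y_elem)
qed

lemma has_Y_Yp:
  assumes "has_Y F P M" "has_Y M MP MM"
  shows "has_Y P (Yp P) (\<lambda>u. MP u + Sp u * P u - Sm u * M u)"
proof -
  have F: "F \<in> elem" and P: "P \<in> elem" using assms has_YD by auto
  have "Ym P \<doteq> Ym (Yp F)"
    by (rule on_shell_eq_Y(2)[OF on_shell_eq_sym[OF has_YD(4)[OF assms(1)]]])
  also have "\<dots> \<doteq> (\<lambda>u. Yp (Ym F) u + Sp u * Yp F u - Sm u * Ym F u)"
    using F by (intro on_shell_eq_dom Y_elem) (simp_all add: Y_commutator)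
  also have "\<dots> \<doteq> (\<lambda>u. MP u + Sp u * P u - Sm u * M u)"
    by (intro on_shell_eq_add on_shell_eq_diff on_shell_eq_mult on_shell_eq_refl[OF Sp_elem]
        on_shell_eq_refl[OF Sm_elem] on_shell_eq_trans[OF on_shell_eq_Y(1) has_YD(4)[OF assms(2)]]
        has_YD(4,5)[OF assms(1)])
  finally show ?thesis using P by (auto simp: has_Y_def intro: on_shell_eq_refl Y_elem)
qed

lemma has_Y_D:
  assumes "has_Y F P M"
  shows "Dx F \<doteq> (\<lambda>u. rho u / 2 * (P u + M u))" "Dy F \<doteq> (\<lambda>u. irho u / 2 * (P u - M u))"
proof -
  have F: "F \<in> elem" and PM: "Yp F \<doteq> P" "Ym F \<doteq> M" using assms has_YD by auto
  have e: "(\<lambda>u. rho u / 2) \<in> elem" "(\<lambda>u. irho u / 2) \<in> elem"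
    by (auto intro!: elem_divide elem_intros rho_elem irho_elem)
  have "Dx F \<doteq> (\<lambda>u. rho u / 2 * (Yp F u + Ym F u))" "Dy F \<doteq> (\<lambda>u. irho u / 2 * (Yp F u - Ym F u))"
    by (intro on_shell_eq_dom D_eq_Y Dx_elem Dy_elem F; assumption)+
  moreover have "(\<lambda>u. rho u / 2 * (Yp F u + Ym F u)) \<doteq> (\<lambda>u. rho u / 2 * (P u + M u))"
    "(\<lambda>u. irho u / 2 * (Yp F u - Ym F u)) \<doteq> (\<lambda>u. irho u / 2 * (P u - M u))"
    by (intro on_shell_eq_mult on_shell_eq_add on_shell_eq_diff on_shell_eq_refl PM e)+
  ultimately show "Dx F \<doteq> (\<lambda>u. rho u / 2 * (P u + M u))" "Dy F \<doteq> (\<lambda>u. irho u / 2 * (P u - M u))"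
    by (blast intro: on_shell_eq_trans)+
qed

lemma has_Y_rho: "has_Y rho (\<lambda>u. rho u * Sp u) (\<lambda>u. rho u * Sm u)"
proof -
  have "Yp rho u = rho u * Sp u" "Ym rho u = rho u * Sm u" if u: "u \<in> jet_domain" for u
    unfolding Yp_def Ym_def Sp_def Sm_def D_rho[OF u] using irho_rho[OF u]
    by (simp add: field_simps; algebra)+
  then show ?thesis unfolding has_Y_def by (auto intro: on_shell_eq_dom Y_elem rho_elem)
qed

lemma has_Y_irho: "has_Y irho (\<lambda>u. - irho u * Sp u) (\<lambda>u. - irho u * Sm u)"
proof -
  have "Yp irho u = - irho u * Sp u" "Ym irho u = - irho u * Sm u" if u: "u \<in> jet_domain" for u
    unfolding Yp_def Ym_def Sp_def Sm_def D_irho[OF u]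
    by (simp_all add: field_simps power3_eq_cube)
  then show ?thesis unfolding has_Y_def by (auto intro: on_shell_eq_dom Y_elem irho_elem)
qed

section \<open>The equation as a pair of Riccati relations for S and T\<close>

lemma D_Sm:
  assumes u: "u \<in> jet_domain"
  shows "Dx Sm u = irho u ^ 3 / 2 * (u (2, 0) - u (0, 0) * u (1, 1) - u (1, 0) * u (0, 1))
      - 3 / 4 * irho u ^ 5 * u (1, 0) * (u (1, 0) - u (0, 0) * u (0, 1))"
    "Dy Sm u = irho u ^ 3 / 2 * (u (1, 1) - u (0, 0) * u (0, 2) - u (0, 1) * u (0, 1))
      - 3 / 4 * irho u ^ 5 * u (0, 1) * (u (1, 0) - u (0, 0) * u (0, 1))"
proof -
  show "Dx Sm u = irho u ^ 3 / 2 * (u (2, 0) - u (0, 0) * u (1, 1) - u (1, 0) * u (0, 1))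
      - 3 / 4 * irho u ^ 5 * u (1, 0) * (u (1, 0) - u (0, 0) * u (0, 1))"
    "Dy Sm u = irho u ^ 3 / 2 * (u (1, 1) - u (0, 0) * u (0, 2) - u (0, 1) * u (0, 1))
      - 3 / 4 * irho u ^ 5 * u (0, 1) * (u (1, 0) - u (0, 0) * u (0, 1))"
    unfolding Sm_def[abs_def] using u
    by (simp_all add: D_rules D_irho irho_elem elem_intros numeral_2_eq_2[symmetric] del: One_nat_def)
      (simp_all add: algebra_simps power2_eq_square eval_nat_numeral)
qed

lemma D_Sp:
  assumes u: "u \<in> jet_domain"
  shows "Dx Sp u = irho u ^ 3 / 2 * (u (2, 0) + u (0, 0) * u (1, 1) + u (1, 0) * u (0, 1))
      - 3 / 4 * irho u ^ 5 * u (1, 0) * (u (1, 0) + u (0, 0) * u (0, 1))"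
    "Dy Sp u = irho u ^ 3 / 2 * (u (1, 1) + u (0, 0) * u (0, 2) + u (0, 1) * u (0, 1))
      - 3 / 4 * irho u ^ 5 * u (0, 1) * (u (1, 0) + u (0, 0) * u (0, 1))"
proof -
  show "Dx Sp u = irho u ^ 3 / 2 * (u (2, 0) + u (0, 0) * u (1, 1) + u (1, 0) * u (0, 1))
      - 3 / 4 * irho u ^ 5 * u (1, 0) * (u (1, 0) + u (0, 0) * u (0, 1))"
    "Dy Sp u = irho u ^ 3 / 2 * (u (1, 1) + u (0, 0) * u (0, 2) + u (0, 1) * u (0, 1))
      - 3 / 4 * irho u ^ 5 * u (0, 1) * (u (1, 0) + u (0, 0) * u (0, 1))"
    unfolding Sp_def[abs_def] using u
    by (simp_all add: D_rules D_irho irho_elem elem_intros numeral_2_eq_2[symmetric] del: One_nat_def)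
      (simp_all add: algebra_simps power2_eq_square eval_nat_numeral)
qed

text \<open>The place where the equation enters. The mixed derivative z_xy cancels, and the
  second-order part left over, (z_xx / z^2 - z_yy) / 2, is -1/2 times that of
  \<open>cae\<close>.\<close>

lemma Yp_Sm_Ym_Sp:
  assumes u: "u \<in> jet_domain"
  shows "Yp Sm u = 1 + Sm u * Sm u + (- 1 / 2) * cae u"
    "Ym Sp u = 1 + Sp u * Sp u + (- 1 / 2) * cae u"
proof -
  \<comment> \<open>Everything is expressed through \<open>irho\<close>, which turns the claim into
    a rational identity.\<close>
  have z: "u (0, 0) = 1 / irho u ^ 2" and i: "inv_z u = irho u ^ 2" and nz: "irho u \<noteq> 0"
    using irho_rho[OF u] rho_sq[OF u] inv_z_irho[OF u] by (auto simp: irho_def power2_eq_square)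
  show "Yp Sm u = 1 + Sm u * Sm u + (- 1 / 2) * cae u"
    "Ym Sp u = 1 + Sp u * Sp u + (- 1 / 2) * cae u"
    unfolding Yp_def Ym_def D_Sm[OF u] D_Sp[OF u] cae_explicit[OF u] Sm_def Sp_def z i using nz
    by (simp_all add: field_simps) (simp_all add: algebra_simps eval_nat_numeral)
qed

lemma Yp_Sm: "Yp Sm \<doteq> (\<lambda>u. 1 + Sm u * Sm u)"
  and Ym_Sp: "Ym Sp \<doteq> (\<lambda>u. 1 + Sp u * Sp u)"
  by (rule on_shell_eqI[OF _ elem_const[of "- 1 / 2"]]; simp add: Y_elem Sm_elem Sp_elem Yp_Sm_Ym_Sp)+

section \<open>The variables C and w and their characteristic derivatives\<close>

definition Cm :: "jet \<Rightarrow> real" where "Cm u = sqrt (1 + Sm u * Sm u)"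
definition iCm :: "jet \<Rightarrow> real" where "iCm u = 1 / Cm u"

lemma Cm_sq: "Cm u * Cm u = 1 + Sm u * Sm u"
  by (simp add: Cm_def add_nonneg_nonneg)

lemma Cm_pos: "Cm u > 0"
  by (simp add: Cm_def add_pos_nonneg)

lemma iCm_Cm: "iCm u * Cm u = 1"
  using Cm_pos[of u] by (simp add: iCm_def)

lemma Cm_elem: "Cm \<in> elem"
  unfolding Cm_def by (intro elem_sqrt elem_intros Sm_elem) (simp add: add_pos_nonneg)

lemma iCm_elem: "iCm \<in> elem"
  unfolding iCm_def by (intro elem_divide elem_intros Cm_elem Cm_pos)

text \<open>\<open>w1\<close>, \<open>w2\<close> continue S in the \<open>Ym\<close> direction and
  \<open>tau1\<close>, \<open>tau2\<close> continue T in the \<open>Yp\<close> direction; the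
  crosswise derivatives follow from commutators. Starting from S/C instead of S makes
  \<open>Yp w1\<close> free of \<open>w1\<close>.\<close>

definition w1 :: "jet \<Rightarrow> real" where "w1 = Ym (\<lambda>u. Sm u * iCm u)"
definition w2 :: "jet \<Rightarrow> real" where "w2 = Ym w1"
definition tau1 :: "jet \<Rightarrow> real" where "tau1 = Yp Sp"
definition tau2 :: "jet \<Rightarrow> real" where "tau2 = Yp tau1"

lemma Y_Cm:
  assumes u: "u \<in> jet_domain"
  shows "Cm u * Yp Cm u = Sm u * Yp Sm u" "Cm u * Ym Cm u = Sm u * Ym Sm u"
proof -
  have "Yp (\<lambda>u. Cm u * Cm u) u = Yp (\<lambda>u. 1 + Sm u * Sm u) u"
    "Ym (\<lambda>u. Cm u * Cm u) u = Ym (\<lambda>u. 1 + Sm u * Sm u) u"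
    by (simp_all add: Cm_sq)
  then show "Cm u * Yp Cm u = Sm u * Yp Sm u" "Cm u * Ym Cm u = Sm u * Ym Sm u"
    using u by (simp_all add: Y_mult Y_add Y_const Cm_elem Sm_elem elem_intros)
qed

lemma Y_iCm:
  assumes u: "u \<in> jet_domain"
  shows "Yp iCm u = - (iCm u)\<^sup>2 * Yp Cm u" "Ym iCm u = - (iCm u)\<^sup>2 * Ym Cm u"
proof -
  have "Yp (\<lambda>u. iCm u * Cm u) u = 0" "Ym (\<lambda>u. iCm u * Cm u) u = 0"
    by (simp_all add: iCm_Cm Y_const)
  then have "iCm u * Yp Cm u + Yp iCm u * Cm u = 0" "iCm u * Ym Cm u + Ym iCm u * Cm u = 0"
    using u by (simp_all add: Y_mult Cm_elem iCm_elem)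
  then show "Yp iCm u = - (iCm u)\<^sup>2 * Yp Cm u" "Ym iCm u = - (iCm u)\<^sup>2 * Ym Cm u"
    using iCm_Cm[of u] by algebra+
qed

text \<open>The derivative of S / sqrt (1 + S^2) with respect to S is 1 / C^3.\<close>

lemma Ym_Sm:
  assumes u: "u \<in> jet_domain"
  shows "Ym Sm u = Cm u ^ 3 * w1 u"
proof -
  have "w1 u = Sm u * Ym iCm u + Ym Sm u * iCm u"
    using u by (simp add: w1_def Y_mult Sm_elem iCm_elem)
  then show ?thesis
    using Y_Cm(2)[OF u] Y_iCm(2)[OF u] iCm_Cm[of u] Cm_sq[of u] by algebra
qed

lemma has_Y_Sm: "has_Y Sm (\<lambda>u. 1 + Sm u * Sm u) (\<lambda>u. Cm u ^ 3 * w1 u)"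
  unfolding has_Y_def using Yp_Sm by (auto intro: on_shell_eq_dom Y_elem Sm_elem Ym_Sm)

lemma has_Y_Sp: "has_Y Sp tau1 (\<lambda>u. 1 + Sp u * Sp u)"
  unfolding has_Y_def tau1_def using Ym_Sp by (auto intro: on_shell_eq_refl Y_elem Sp_elem)

lemma has_Y_Cm: "has_Y Cm (\<lambda>u. Cm u * Sm u) (\<lambda>u. Cm u ^ 2 * (Sm u * w1 u))"
proof -
  have "Yp Cm u = (iCm u * Sm u) * Yp Sm u" "Ym Cm u = (iCm u * Sm u) * Ym Sm u"
    if u: "u \<in> jet_domain" for u
    using Y_Cm[OF u] iCm_Cm[of u] by algebra+
  then have "Yp Cm \<doteq> (\<lambda>u. (iCm u * Sm u) * Yp Sm u)" "Ym Cm \<doteq> (\<lambda>u. (iCm u * Sm u) * Ym Sm u)"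
    by (auto intro!: on_shell_eq_dom Y_elem Cm_elem)
  moreover have "(\<lambda>u. (iCm u * Sm u) * Yp Sm u) \<doteq> (\<lambda>u. (iCm u * Sm u) * (1 + Sm u * Sm u))"
    "(\<lambda>u. (iCm u * Sm u) * Ym Sm u) \<doteq> (\<lambda>u. (iCm u * Sm u) * (Cm u ^ 3 * w1 u))"
    by (intro on_shell_eq_mult[OF _ has_YD(4)[OF has_Y_Sm]] on_shell_eq_mult[OF _ has_YD(5)[OF has_Y_Sm]]
        on_shell_eq_refl elem_intros iCm_elem Sm_elem)+
  ultimately have "has_Y Cm (\<lambda>u. (iCm u * Sm u) * (1 + Sm u * Sm u)) (\<lambda>u. (iCm u * Sm u) * (Cm u ^ 3 * w1 u))"
    unfolding has_Y_def using Cm_elem on_shell_eq_trans by blast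
  then show ?thesis
  proof (rule has_Y_eq)
    fix u
    show "(iCm u * Sm u) * (1 + Sm u * Sm u) = Cm u * Sm u"
      "(iCm u * Sm u) * (Cm u ^ 3 * w1 u) = Cm u ^ 2 * (Sm u * w1 u)"
      using iCm_Cm[of u] Cm_sq[of u] by algebra+
  qed
qed

lemma has_Y_iCm: "has_Y iCm (\<lambda>u. - Sm u * iCm u) (\<lambda>u. - Sm u * w1 u)"
proof -
  have "Yp iCm \<doteq> (\<lambda>u. - (iCm u)\<^sup>2 * Yp Cm u)" "Ym iCm \<doteq> (\<lambda>u. - (iCm u)\<^sup>2 * Ym Cm u)"
    by (intro on_shell_eq_dom Y_elem iCm_elem Y_iCm; assumption)+
  moreover have "(\<lambda>u. - (iCm u)\<^sup>2 * Yp Cm u) \<doteq> (\<lambda>u. - (iCm u)\<^sup>2 * (Cm u * Sm u))"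
    "(\<lambda>u. - (iCm u)\<^sup>2 * Ym Cm u) \<doteq> (\<lambda>u. - (iCm u)\<^sup>2 * (Cm u ^ 2 * (Sm u * w1 u)))"
    by (intro on_shell_eq_mult[OF _ has_YD(4)[OF has_Y_Cm]] on_shell_eq_mult[OF _ has_YD(5)[OF has_Y_Cm]]
        on_shell_eq_refl elem_intros iCm_elem)+
  ultimately have "has_Y iCm (\<lambda>u. - (iCm u)\<^sup>2 * (Cm u * Sm u)) (\<lambda>u. - (iCm u)\<^sup>2 * (Cm u ^ 2 * (Sm u * w1 u)))"
    unfolding has_Y_def using iCm_elem on_shell_eq_trans by blast
  then show ?thesis
  proof (rule has_Y_eq)
    fix u
    show "- (iCm u)\<^sup>2 * (Cm u * Sm u) = - Sm u * iCm u"
      "- (iCm u)\<^sup>2 * (Cm u ^ 2 * (Sm u * w1 u)) = - Sm u * w1 u"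
      using iCm_Cm[of u] by algebra+
  qed
qed

text \<open>Put S = sinh a, so C = cosh a and S/C = tanh a. The Riccati relation says that
  \<open>Yp\<close> sends a to cosh a, hence tanh a to 1 / cosh a.\<close>

lemma has_Y_tanh: "has_Y (\<lambda>u. Sm u * iCm u) iCm w1"
proof -
  have "has_Y (\<lambda>u. Sm u * iCm u) iCm (\<lambda>u. Sm u * (- Sm u * w1 u) + Cm u ^ 3 * w1 u * iCm u)"
    by (rule has_Y_eq[OF has_Y_mult[OF has_Y_Sm has_Y_iCm]]) (simp_all add: algebra_simps)
  then show ?thesis
  proof (rule has_Y_eq)
    fix u
    show "Sm u * (- Sm u * w1 u) + Cm u ^ 3 * w1 u * iCm u = w1 u"
      using iCm_Cm[of u] Cm_sq[of u] by algebra
  qed simp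
qed

text \<open>The commutator contributes \<open>Sm u * w1 u\<close> and \<open>Ym iCm\<close>
  contributes its negative, so only the term with \<open>Sp\<close> survives.\<close>

lemma has_Y_w1: "has_Y w1 (\<lambda>u. - (Sp u * iCm u)) w2"
  unfolding w2_def
  by (rule has_Y_eq[OF has_Y_Ym[OF has_Y_tanh has_Y_iCm]]) (simp_all add: algebra_simps)

lemma has_Y_tau1: "has_Y tau1 tau2 (\<lambda>u. 3 * Sp u * tau1 u - Sm u * (1 + Sp u * Sp u))"
  unfolding tau2_def
  by (rule has_Y_eq[OF has_Y_Yp[OF has_Y_Sp
        has_Y_add[OF has_Y_const[of 1] has_Y_mult[OF has_Y_Sp has_Y_Sp]]]])
    (simp_all add: algebra_simps)

lemma has_Y_w2:
  "has_Y w2 (\<lambda>u. Sp u * Sm u * w1 u + Sm u * w2 u - iCm u) (Ym w2)"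
  by (rule has_Y_eq[OF has_Y_Ym[OF has_Y_w1 has_Y_minus[OF has_Y_mult[OF has_Y_Sp has_Y_iCm]]]])
    (simp_all add: algebra_simps)

lemmas has_Y_intros = has_Y_const has_Y_minus has_Y_diff has_Y_add has_Y_mult has_Y_divide_const has_Y_power
  has_Y_rho has_Y_irho has_Y_Sm has_Y_Sp has_Y_Cm has_Y_iCm has_Y_w1 has_Y_w2 has_Y_tau1

text \<open>\<open>P\<close> and \<open>M\<close> are absent from the conclusion: the
  \<open>has_Y\<close> rules compute them, and a pointwise identity is left to check.\<close>

lemma has_Y_Dx_eq:
  assumes "has_Y F P M" "\<And>u. u \<in> jet_domain \<Longrightarrow> rho u / 2 * (P u + M u) = G u"
  shows "Dx F \<doteq> G"
  by (rule on_shell_eq_trans[OF has_Y_D(1)[OF assms(1)]], rule on_shell_eq_dom)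
    (use assms has_Y_D(1)[OF assms(1)] on_shell_eq_elem in auto)

lemma has_Y_Dy_eq:
  assumes "has_Y F P M" "\<And>u. u \<in> jet_domain \<Longrightarrow> irho u / 2 * (P u - M u) = G u"
  shows "Dy F \<doteq> G"
  by (rule on_shell_eq_trans[OF has_Y_D(2)[OF assms(1)]], rule on_shell_eq_dom)
    (use assms has_Y_D(2)[OF assms(1)] on_shell_eq_elem in auto)

section \<open>The symmetry condition\<close>

text \<open>With Z = zV the two differentiated functions are zV and V/z. Since \<open>Yp\<close> and
  \<open>Ym\<close> are characteristic, the pure second derivatives \<open>PP\<close> and
  \<open>Ym M\<close> cancel in the difference. Its vanishing is a condition on the mixed derivative
  \<open>PM\<close> alone.\<close>

lemma linearization:
  assumes V: "has_Y V P M" and P: "has_Y P PP PM"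
  shows "(\<lambda>u. Dy (Dy (\<lambda>u. rho u ^ 2 * V u)) u - Dx (Dx (\<lambda>u. irho u ^ 2 * V u)) u) \<doteq>
    (\<lambda>u. 2 * Sp u * P u + Sm u * M u + (tau1 u + Cm u ^ 3 * w1 u - 2 * Sp u * Sm u) * V u - PM u)"
proof -
  note M = has_Y_Ym[OF V P]
  have "Dy (\<lambda>u. rho u ^ 2 * V u) \<doteq> (\<lambda>u. rho u / 2 * (P u - M u + 2 * (Sp u - Sm u) * V u))"
    by (rule has_Y_Dy_eq, (rule has_Y_intros V)+)
      (drule rho_pos, simp add: irho_def field_simps power2_eq_square)
  then have "Dy (Dy (\<lambda>u. rho u ^ 2 * V u)) \<doteq>
      Dy (\<lambda>u. rho u / 2 * (P u - M u + 2 * (Sp u - Sm u) * V u))"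
    by (rule on_shell_eq_Dy)
  moreover have "Dy (\<lambda>u. rho u / 2 * (P u - M u + 2 * (Sp u - Sm u) * V u)) \<doteq>
      (\<lambda>u. ((PP u - (PM u - Sp u * P u + Sm u * M u) + 2 * (tau1 u - (1 + Sm u * Sm u)) * V u
          + 2 * (Sp u - Sm u) * P u)
        - (PM u - Ym M u + 2 * (1 + Sp u * Sp u - Cm u ^ 3 * w1 u) * V u + 2 * (Sp u - Sm u) * M u)
        + (Sp u - Sm u) * (P u - M u + 2 * (Sp u - Sm u) * V u)) / 4)"
    by (rule has_Y_Dy_eq, (rule has_Y_intros V P M)+)
      (drule rho_pos, simp add: irho_def field_simps)
  ultimately have y: "Dy (Dy (\<lambda>u. rho u ^ 2 * V u)) \<doteq>
      (\<lambda>u. ((PP u - (PM u - Sp u * P u + Sm u * M u) + 2 * (tau1 u - (1 + Sm u * Sm u)) * V u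
          + 2 * (Sp u - Sm u) * P u)
        - (PM u - Ym M u + 2 * (1 + Sp u * Sp u - Cm u ^ 3 * w1 u) * V u + 2 * (Sp u - Sm u) * M u)
        + (Sp u - Sm u) * (P u - M u + 2 * (Sp u - Sm u) * V u)) / 4)"
    by (rule on_shell_eq_trans)
  have "Dx (\<lambda>u. irho u ^ 2 * V u) \<doteq> (\<lambda>u. irho u / 2 * (P u + M u - 2 * (Sp u + Sm u) * V u))"
    by (rule has_Y_Dx_eq, (rule has_Y_intros V)+)
      (drule rho_pos, simp add: irho_def field_simps power2_eq_square)
  then have "Dx (Dx (\<lambda>u. irho u ^ 2 * V u)) \<doteq>
      Dx (\<lambda>u. irho u / 2 * (P u + M u - 2 * (Sp u + Sm u) * V u))"
    by (rule on_shell_eq_Dx)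
  moreover have "Dx (\<lambda>u. irho u / 2 * (P u + M u - 2 * (Sp u + Sm u) * V u)) \<doteq>
      (\<lambda>u. ((PP u + (PM u - Sp u * P u + Sm u * M u) - 2 * (tau1 u + (1 + Sm u * Sm u)) * V u
          - 2 * (Sp u + Sm u) * P u)
        + (PM u + Ym M u - 2 * (1 + Sp u * Sp u + Cm u ^ 3 * w1 u) * V u - 2 * (Sp u + Sm u) * M u)
        - (Sp u + Sm u) * (P u + M u - 2 * (Sp u + Sm u) * V u)) / 4)"
    by (rule has_Y_Dx_eq, (rule has_Y_intros V P M)+)
      (drule rho_pos, simp add: irho_def field_simps)
  ultimately have x: "Dx (Dx (\<lambda>u. irho u ^ 2 * V u)) \<doteq>
      (\<lambda>u. ((PP u + (PM u - Sp u * P u + Sm u * M u) - 2 * (tau1 u + (1 + Sm u * Sm u)) * V u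
          - 2 * (Sp u + Sm u) * P u)
        + (PM u + Ym M u - 2 * (1 + Sp u * Sp u + Cm u ^ 3 * w1 u) * V u - 2 * (Sp u + Sm u) * M u)
        - (Sp u + Sm u) * (P u + M u - 2 * (Sp u + Sm u) * V u)) / 4)"
    by (rule on_shell_eq_trans)
  show ?thesis
    by (rule on_shell_eq_trans[OF on_shell_eq_diff[OF y x]], rule on_shell_eq_dom)
      (rule elem_diff[OF on_shell_eq_elem(2)[OF y] on_shell_eq_elem(2)[OF x]], simp add: field_simps)
qed

definition V_red :: "jet \<Rightarrow> real" where
  "V_red u = w2 u + Sp u * w1 u"

lemma has_Y_V_red:
  "has_Y V_red (\<lambda>u. Sm u * V_red u + tau1 u * w1 u - (1 + Sp u * Sp u) * iCm u) (Ym V_red)"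
proof -
  have "has_Y V_red (\<lambda>u. Sm u * V_red u + tau1 u * w1 u - (1 + Sp u * Sp u) * iCm u)
      (\<lambda>u. Ym w2 u + (Sp u * w2 u + (1 + Sp u * Sp u) * w1 u))"
    unfolding V_red_def[abs_def]
    by (rule has_Y_eq, (rule has_Y_intros)+) (simp_all add: algebra_simps)
  \<comment> \<open>The formula found for the \<open>Ym\<close> component is replaced by
    \<open>Ym V_red\<close> itself, which can stay opaque in the symmetry condition.\<close>
  then show ?thesis
    by (auto simp: has_Y_def intro: on_shell_eq_refl Y_elem)
qed

text \<open>The constant \<open>c\<close> lets one verification serve both generators, with 1/16 for
  \<open>Z_gen\<close> and -1/16 for its conjugate.\<close>

lemma symmetry_generatorI:
  assumes Z: "Z \<doteq> (\<lambda>u. rho u ^ 2 * (c * V_red u))"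
  shows "symmetry_generator Z"
  unfolding symmetry_generator_def
proof (intro conjI ballI)
  show "differential_function Z" using on_shell_eq_elem(1)[OF Z] by (rule elem_differential_function)
  fix u assume u: "u \<in> cae_jets"
  define P where "P = (\<lambda>u. c * (Sm u * V_red u + tau1 u * w1 u - (1 + Sp u * Sp u) * iCm u))"
  have V: "has_Y (\<lambda>u. c * V_red u) P (\<lambda>u. c * Ym V_red u)"
    by (rule has_Y_eq[OF has_Y_mult[OF has_Y_const has_Y_V_red]]) (simp_all add: P_def)
  \<comment> \<open>The last component is the reduced symmetry condition: it is the value of
    \<open>PM\<close> for which the right-hand side of \<open>linearization\<close> is zero.\<close>
  obtain PP where P: "has_Y P PP (\<lambda>u. 2 * Sp u * P u + Sm u * (c * Ym V_red u)
      + (tau1 u + Cm u ^ 3 * w1 u - 2 * Sp u * Sm u) * (c * V_red u))"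
  proof
    show "has_Y P (Yp P) (\<lambda>u. 2 * Sp u * P u + Sm u * (c * Ym V_red u)
      + (tau1 u + Cm u ^ 3 * w1 u - 2 * Sp u * Sm u) * (c * V_red u))"
    proof -
      have "\<exists>PP. has_Y P PP (\<lambda>u. 2 * Sp u * P u + Sm u * (c * Ym V_red u)
          + (tau1 u + Cm u ^ 3 * w1 u - 2 * Sp u * Sm u) * (c * V_red u))"
        unfolding P_def
        by (rule exI, rule has_Y_eq, (rule has_Y_intros has_Y_V_red)+)
          (rule refl, simp add: V_red_def algebra_simps)
      then show ?thesis by (auto simp: has_Y_def intro: on_shell_eq_refl Y_elem)
    qed
  qed
  have inv: "(\<lambda>v. Z v / (v (0, 0))\<^sup>2) \<doteq> (\<lambda>u. irho u ^ 2 * (c * V_red u))"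
  proof -
    have "(\<lambda>v. Z v / (v (0, 0))\<^sup>2) \<doteq> (\<lambda>u. irho u ^ 4 * Z u)"
    proof (rule on_shell_eq_dom)
      show "(\<lambda>v. Z v / (v (0, 0))\<^sup>2) \<in> elem"
        using on_shell_eq_elem(1)[OF Z] by (intro elem_divide elem_intros) (auto dest: z_pos)
      fix v assume "v \<in> jet_domain"
      then have "v (0, 0) = rho v * rho v" "rho v > 0" by (simp_all add: rho_sq rho_pos)
      then show "Z v / (v (0, 0))\<^sup>2 = irho v ^ 4 * Z v"
        by (simp add: irho_def field_simps power2_eq_square power4_eq_xxxx)
    qed
    also have "\<dots> \<doteq> (\<lambda>u. irho u ^ 4 * (rho u ^ 2 * (c * V_red u)))"
      by (intro on_shell_eq_mult on_shell_eq_refl elem_intros irho_elem Z)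
    also have "\<dots> \<doteq> (\<lambda>u. irho u ^ 2 * (c * V_red u))"
    proof (rule on_shell_eq_dom)
      show "(\<lambda>u. irho u ^ 4 * (rho u ^ 2 * (c * V_red u))) \<in> elem"
        by (intro elem_mult elem_power elem_const irho_elem rho_elem has_YD(1)[OF has_Y_V_red])
      fix v assume "v \<in> jet_domain"
      from irho_rho[OF this]
      show "irho v ^ 4 * (rho v ^ 2 * (c * V_red v)) = irho v ^ 2 * (c * V_red v)" by algebra
    qed
    finally show ?thesis .
  qed
  have "Dy (Dy Z) u - Dx (Dx (\<lambda>v. Z v / (v (0, 0))\<^sup>2)) u =
      Dy (Dy (\<lambda>u. rho u ^ 2 * (c * V_red u))) u - Dx (Dx (\<lambda>u. irho u ^ 2 * (c * V_red u))) u"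
    using on_shell_eq_eq[OF on_shell_eq_Dy[OF on_shell_eq_Dy[OF Z]] u]
      on_shell_eq_eq[OF on_shell_eq_Dx[OF on_shell_eq_Dx[OF inv]] u] by simp
  also have "\<dots> = 0"
    using on_shell_eq_eq[OF linearization[OF V P] u] by simp
  finally show "Dy (Dy Z) u - Dx (Dx (\<lambda>v. Z v / (v (0, 0))\<^sup>2)) u = 0" .
qed

section \<open>The generator in characteristic variables\<close>

text \<open>The generator as a function of real arguments, so that the same algebra applies to the
  jets of z and of 1/z. With \<open>K\<close> a separate argument it is polynomial in the
  derivatives.\<close>

definition Z_num :: "real \<Rightarrow> real \<Rightarrow> real \<Rightarrow> real \<Rightarrow> real \<Rightarrow> real \<Rightarrow> real \<Rightarrow> real \<Rightarrow> real" where
  "Z_num K z z_x z_y z_xx z_xy z_xxx z_xxy =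
       z^3 / K^3 * (z_xxx - z * z_xxy)
        - 3 / K^5 * z^3 * (z_x - z * z_y) * (z_xx - z * z_xy)^2
        - 2 / K^5 * z^5 * (9 * z_x - z * z_y) * z_xx
        + 1 / (2 * K^5) * z^2 * (9 * z_x^2 + 4 * z * z_x * z_y - z^2 * z_y^2)
            * (z_x - z * z_y) * z_xx
        - 2 / K^5 * z^3 * z_x * (z_x - z * z_y) * (4 * z_x - z * z_y) * z_xy
        + 4 / K^5 * z^6 * z_x * z_xy
        + 3 / K^5 * z^4 * (5 * z_x - z * z_y) * z_x^2
        - 3 / K^5 * z * (z_x - z * z_y) * z_x^4"

definition K_num :: "real \<Rightarrow> real \<Rightarrow> real \<Rightarrow> real" where
  "K_num z z_x z_y = sqrt ((z_x - z * z_y)^2 + 4 * z^3)"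

lemma Z_gen_eq:
  "Z_gen u = Z_num (K_num (u (0, 0)) (u (1, 0)) (u (0, 1))) (u (0, 0)) (u (1, 0)) (u (0, 1))
    (u (2, 0)) (u (1, 1)) (u (3, 0)) (u (2, 1))"
  by (simp add: Z_gen_def Z_num_def K_num_def Let_def)

lemma K_num_pos: "z > 0 \<Longrightarrow> K_num z p q > 0"
  by (simp add: K_num_def add_nonneg_pos)

lemma K_num_elem:
  assumes "f \<in> elem" "g \<in> elem" "h \<in> elem" "\<And>u. u \<in> jet_domain \<Longrightarrow> f u > 0"
  shows "(\<lambda>u. K_num (f u) (g u) (h u)) \<in> elem"
  unfolding K_num_def using assms
  by (intro elem_sqrt elem_intros) (auto simp: add_nonneg_pos)

lemma on_shell_eq_divide:
  assumes "F \<doteq> G" "H \<in> elem" "\<And>u. u \<in> jet_domain \<Longrightarrow> H u > 0"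
  shows "(\<lambda>u. F u / H u) \<doteq> (\<lambda>u. G u / H u)"
proof -
  have "(\<lambda>u. 1 / H u) \<in> elem"
    by (intro elem_divide elem_const assms)
  from on_shell_eq_mult[OF assms(1) on_shell_eq_refl[OF this]] show ?thesis by simp
qed

text \<open>Only second- and third-order arguments are replaced. \<open>K\<close> involves the first
  jet alone, so no congruence has to pass under its square root.\<close>

lemma Z_num_cong:
  assumes "K \<in> elem" "\<And>u. u \<in> jet_domain \<Longrightarrow> K u > 0"
    and "f \<in> elem" "g \<in> elem" "h \<in> elem"
    and "a \<doteq> a'" "b \<doteq> b'" "c \<doteq> c'" "d \<doteq> d'"
  shows "(\<lambda>u. Z_num (K u) (f u) (g u) (h u) (a u) (b u) (c u) (d u)) \<doteq>
    (\<lambda>u. Z_num (K u) (f u) (g u) (h u) (a' u) (b' u) (c' u) (d' u))"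
  unfolding Z_num_def
  by (intro on_shell_eq_add on_shell_eq_diff on_shell_eq_mult on_shell_eq_power on_shell_eq_divide
      assms(6-9) on_shell_eq_refl[OF assms(1)] on_shell_eq_refl[OF assms(3)] on_shell_eq_refl[OF assms(4)]
      on_shell_eq_refl[OF assms(5)] on_shell_eq_refl[OF elem_const] elem_intros assms(1))
    (use assms(2) in auto)

(* On the equation, with D = Ym S, E = Ym D, t = Yp T, q = Yp t, the jets z_xx, z_xy, z_xxx, z_xxy
   are these polynomials times s^4, s^2, s^5, s^3. *)
definition jet_xx where "jet_xx S T D t = 2 * S^2 + 3 * S * T + 2 * T^2 + (D + t) / 2 + (1::real)"
definition jet_xy where "jet_xy S T D t = T^2 - S^2 + (t - D) / (2::real)"
definition jet_xxx where "jet_xxx S T D t E q = 6 * S^3 + 45/4 * S^2 * T + 45/4 * S * T^2 + 6 * T^3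
  + 15/4 * S * D + 5/2 * T * D + 5/2 * S * t + 15/4 * T * t + 21/4 * (S + T) + (E + q) / (4::real)"
definition jet_xxy where "jet_xxy S T D t E q = - 2 * S^3 - 3/4 * S^2 * T + 3/4 * S * T^2 + 2 * T^3
  - 9/4 * S * D - 1/2 * T * D + 1/2 * S * t + 9/4 * T * t + 5/4 * (T - S) + (q - E) / (4::real)"

text \<open>A homogeneity count: with the weights in \<open>s\<close> shown here, and weight 3 for
  \<open>K\<close>, every summand of Z has weight 2. The factor 32 * C^5 comes from K^5, and the 4 *
  C^2 makes up for the first summand having only K^3 below.\<close>

lemma Z_num_scale:
  assumes "s > 0" "C > 0"
  shows "Z_num (2 * s^3 * C) (s^2) (s^3 * (S + T)) (s * (T - S)) (s^4 * a) (s^2 * b) (s^5 * c) (s^3 * d) =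
    s^2 / (32 * C^5) * (4 * C^2 * (c - d) - 6 * S * (a - b)^2 - 2 * (10 * S + 8 * T) * a
      + (9 * (S + T)^2 + 4 * (S + T) * (T - S) - (T - S)^2) * S * a
      - 4 * (S + T) * S * (5 * S + 3 * T) * b + 4 * (S + T) * b
      + 3 * (6 * S + 4 * T) * (S + T)^2 - 6 * S * (S + T)^4)"
proof -
  define r where "r = s^2 / (32 * C^5)"
  have t1: "(s^2)^3 / (2 * s^3 * C)^3 * (s^5 * c - s^2 * (s^3 * d)) = r * (4 * C^2 * (c - d))"
    using assms by (simp add: r_def power_mult_distrib power_mult[symmetric] divide_simps; algebra)
  have t2: "3 / (2 * s^3 * C)^5 * (s^2)^3 * (2 * s^3 * S) * (s^4 * a - s^2 * (s^2 * b))^2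
      = r * (6 * S * (a - b)^2)"
    using assms by (simp add: r_def power_mult_distrib power_mult[symmetric] divide_simps; algebra)
  have t3: "2 / (2 * s^3 * C)^5 * (s^2)^5 * (s^3 * (10 * S + 8 * T)) * (s^4 * a)
      = r * (2 * (10 * S + 8 * T) * a)"
    using assms by (simp add: r_def power_mult_distrib power_mult[symmetric] divide_simps; algebra)
  \<comment> \<open>Here \<open>q\<close> stands for the quadratic form in z_x and z_y, which the
    last equation of \<open>lin\<close> supplies.\<close>
  have t4: "1 / (2 * (2 * s^3 * C)^5) * (s^2)^2 * (s^6 * q) * (2 * s^3 * S) * (s^4 * a)
      = r * (q * S * a)" for q
    using assms by (simp add: r_def power_mult_distrib power_mult[symmetric] divide_simps; algebra)
  have t5: "2 / (2 * s^3 * C)^5 * (s^2)^3 * (s^3 * (S + T)) * (2 * s^3 * S) * (s^3 * (5 * S + 3 * T)) * (s^2 * b)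
      = r * (4 * (S + T) * S * (5 * S + 3 * T) * b)"
    using assms by (simp add: r_def power_mult_distrib power_mult[symmetric] divide_simps; algebra)
  have t6: "4 / (2 * s^3 * C)^5 * (s^2)^6 * (s^3 * (S + T)) * (s^2 * b) = r * (4 * (S + T) * b)"
    using assms by (simp add: r_def power_mult_distrib power_mult[symmetric] divide_simps; algebra)
  have t7: "3 / (2 * s^3 * C)^5 * (s^2)^4 * (s^3 * (6 * S + 4 * T)) * (s^3 * (S + T))^2
      = r * (3 * (6 * S + 4 * T) * (S + T)^2)"
    using assms by (simp add: r_def power_mult_distrib power_mult[symmetric] divide_simps; algebra)
  have t8: "3 / (2 * s^3 * C)^5 * s^2 * (2 * s^3 * S) * (s^3 * (S + T))^4 = r * (6 * S * (S + T)^4)"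
    using assms by (simp add: r_def power_mult_distrib power_mult[symmetric] divide_simps; algebra)
  have lin: "s^3 * (S + T) - s^2 * (s * (T - S)) = 2 * s^3 * S"
    "9 * (s^3 * (S + T)) - s^2 * (s * (T - S)) = s^3 * (10 * S + 8 * T)"
    "4 * (s^3 * (S + T)) - s^2 * (s * (T - S)) = s^3 * (5 * S + 3 * T)"
    "5 * (s^3 * (S + T)) - s^2 * (s * (T - S)) = s^3 * (6 * S + 4 * T)"
    "9 * (s^3 * (S + T))^2 + 4 * s^2 * (s^3 * (S + T)) * (s * (T - S)) - (s^2)^2 * (s * (T - S))^2
      = s^6 * (9 * (S + T)^2 + 4 * (S + T) * (T - S) - (T - S)^2)"
    by algebra+
  show ?thesis
    unfolding Z_num_def r_def[symmetric] lin t1 t2 t3 t4 t5 t6 t7 t8 by (simp add: algebra_simps)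
qed

(* On the equation the quantity Yp T drops out of the generator. *)
lemma numerator_identity:
  "4 * (1 + S^2) * (jet_xxx S T D t E q - jet_xxy S T D t E q) - 6 * S * (jet_xx S T D t - jet_xy S T D t)^2
      - 2 * (10 * S + 8 * T) * jet_xx S T D t
      + (9 * (S + T)^2 + 4 * (S + T) * (T - S) - (T - S)^2) * S * jet_xx S T D t
      - 4 * (S + T) * S * (5 * S + 3 * T) * jet_xy S T D t + 4 * (S + T) * jet_xy S T D t
      + 3 * (6 * S + 4 * T) * (S + T)^2 - 6 * S * (S + T)^4 =
    2 * (1 + S^2) * (E + T * D) - 6 * S * D^2"
  unfolding jet_xx_def jet_xy_def jet_xxx_def jet_xxy_def
  by (simp add: field_simps eval_nat_numeral)

lemma K_num_scale:
  assumes "s > 0" "C > 0" "C * C = 1 + S * S"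
  shows "K_num (s^2) (s^3 * (S + T)) (s * (T - S)) = 2 * s^3 * C"
proof -
  have "(s^3 * (S + T) - s^2 * (s * (T - S)))^2 + 4 * (s^2)^3 = (2 * s^3 * C)^2"
    using assms(3) by algebra
  then show ?thesis
    using assms by (simp add: K_num_def real_sqrt_unique)
qed

text \<open>Substituting D = C^3 w and E = 3 S C^4 w^2 + C^3 v into the numerator cancels the terms
  in w^2. The rest has the factor 2 * C^5, which removes the denominator and leaves 1/16.\<close>

lemma Z_num_on_shell:
  assumes "s > 0" "C > 0" "C * C = 1 + S * S"
  shows "Z_num (K_num (s^2) (s^3 * (S + T)) (s * (T - S))) (s^2) (s^3 * (S + T)) (s * (T - S))
      (s^4 * jet_xx S T (C^3 * w) t) (s^2 * jet_xy S T (C^3 * w) t)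
      (s^5 * jet_xxx S T (C^3 * w) t (3 * S * C^4 * w^2 + C^3 * v) q)
      (s^3 * jet_xxy S T (C^3 * w) t (3 * S * C^4 * w^2 + C^3 * v) q) = s^2 * (v + T * w) / 16"
proof -
  have C2: "C^2 = 1 + S^2" using assms(3) by (simp add: power2_eq_square)
  have eq: "2 * (1 + S^2) * ((3 * S * C^4 * w^2 + C^3 * v) + T * (C^3 * w)) - 6 * S * (C^3 * w)^2
    = 2 * C^5 * (v + T * w)"
    using C2 by algebra
  show ?thesis
    unfolding K_num_scale[OF assms] Z_num_scale[OF assms(1,2)] C2 numerator_identity eq
    using assms(2) by simp
qed

section \<open>Jets of z and of 1/z in characteristic variables\<close>

definition Dm :: "jet \<Rightarrow> real" where "Dm u = Cm u ^ 3 * w1 u"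
text \<open>\<open>Dm\<close> and \<open>Em\<close> are the D and E of the jet polynomials above,
  expressed through \<open>w1\<close> and \<open>w2\<close>.\<close>

definition Em :: "jet \<Rightarrow> real" where "Em u = 3 * Sm u * Cm u ^ 4 * w1 u ^ 2 + Cm u ^ 3 * w2 u"

lemma has_Y_Dm: "has_Y Dm (\<lambda>u. 3 * Sm u * Dm u - Sp u * (1 + Sm u * Sm u)) Em"
proof -
  have "has_Y Dm (\<lambda>u. 3 * Sm u * Dm u - Sp u * (Cm u ^ 3 * iCm u)) Em"
    unfolding Dm_def[abs_def] Em_def[abs_def]
    by (rule has_Y_eq, (rule has_Y_intros)+) (simp_all add: algebra_simps eval_nat_numeral)
  then show ?thesis
  proof (rule has_Y_eq)
    fix u
    have "Cm u ^ 3 * iCm u = 1 + Sm u * Sm u" using iCm_Cm[of u] Cm_sq[of u] by algebra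
    then show "3 * Sm u * Dm u - Sp u * (Cm u ^ 3 * iCm u) = 3 * Sm u * Dm u - Sp u * (1 + Sm u * Sm u)"
      by simp
  qed simp
qed

lemma z_jets:
  assumes u: "u \<in> jet_domain"
  shows "u (0, 0) = rho u ^ 2" "u (1, 0) = rho u ^ 3 * (Sm u + Sp u)" "u (0, 1) = rho u * (Sp u - Sm u)"
proof -
  have h: "irho u * rho u = 1" "rho u * rho u = u (0, 0)"
    using irho_rho[OF u] rho_sq[OF u] by auto
  have e: "2 * Sp u = irho u ^ 3 * (u (1, 0) + u (0, 0) * u (0, 1))"
    "2 * Sm u = irho u ^ 3 * (u (1, 0) - u (0, 0) * u (0, 1))"
    by (simp_all add: Sp_def Sm_def)
  have "2 * u (1, 0) = rho u ^ 3 * (2 * Sm u + 2 * Sp u)" "2 * u (0, 1) = rho u * (2 * Sp u - 2 * Sm u)"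
    unfolding e h(2)[symmetric] using h(1) by algebra+
  then show "u (0, 0) = rho u ^ 2" "u (1, 0) = rho u ^ 3 * (Sm u + Sp u)" "u (0, 1) = rho u * (Sp u - Sm u)"
    using h by (simp_all add: power2_eq_square algebra_simps)
qed

text \<open>The discrete symmetry at first order: these are the formulas of \<open>z_jets\<close>
  with x and y interchanged, \<open>rho\<close> replaced by \<open>irho\<close> and
  \<open>Sp\<close> by its negative.\<close>

lemma inv_z_jets:
  assumes u: "u \<in> jet_domain"
  shows "inv_z u = irho u ^ 2" "Dy inv_z u = irho u ^ 3 * (Sm u - Sp u)" "Dx inv_z u = irho u * (- Sp u - Sm u)"
proof -
  have h: "irho u * rho u = 1" using irho_rho[OF u] by auto
  show "inv_z u = irho u ^ 2" using inv_z_irho[OF u] by (simp add: power2_eq_square)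
  show "Dy inv_z u = irho u ^ 3 * (Sm u - Sp u)" "Dx inv_z u = irho u * (- Sp u - Sm u)"
    unfolding Dy_inv_z[OF u] Dx_inv_z[OF u] z_jets[OF u] inv_z_irho[OF u] using h by algebra+
qed

text \<open>Each jet is \<open>Dx\<close> of the on-shell expression one order lower; the
  polynomials \<open>jet_xx\<close> to \<open>jet_xxy\<close> record the outcome.\<close>

lemma z_jets_on_shell:
  "(\<lambda>u. u (2, 0)) \<doteq> (\<lambda>u. rho u ^ 4 * jet_xx (Sm u) (Sp u) (Dm u) (tau1 u))"
  "(\<lambda>u. u (1, 1)) \<doteq> (\<lambda>u. rho u ^ 2 * jet_xy (Sm u) (Sp u) (Dm u) (tau1 u))"
  "(\<lambda>u. u (3, 0)) \<doteq> (\<lambda>u. rho u ^ 5 * jet_xxx (Sm u) (Sp u) (Dm u) (tau1 u) (Em u) (tau2 u))"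
  "(\<lambda>u. u (2, 1)) \<doteq> (\<lambda>u. rho u ^ 3 * jet_xxy (Sm u) (Sp u) (Dm u) (tau1 u) (Em u) (tau2 u))"
proof -
  have D: "Dx (\<lambda>u. u (1, 0)) = (\<lambda>u. u (2, 0))" "Dx (\<lambda>u. u (0, 1)) = (\<lambda>u. u (1, 1))"
    "Dx (\<lambda>u. u (2, 0)) = (\<lambda>u. u (3, 0))" "Dx (\<lambda>u. u (1, 1)) = (\<lambda>u. u (2, 1))"
    by (simp_all add: fun_eq_iff Dx_coord numeral_2_eq_2 numeral_3_eq_3)
  have "(\<lambda>u. u (1, 0)) \<doteq> (\<lambda>u. rho u ^ 3 * (Sm u + Sp u))"
    "(\<lambda>u. u (0, 1)) \<doteq> (\<lambda>u. rho u * (Sp u - Sm u))"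
    by (rule on_shell_eq_dom, rule elem_coord, erule z_jets)+
  note 1 = this[THEN on_shell_eq_Dx, unfolded D]
  show xx: "(\<lambda>u. u (2, 0)) \<doteq> (\<lambda>u. rho u ^ 4 * jet_xx (Sm u) (Sp u) (Dm u) (tau1 u))"
    by (rule on_shell_eq_trans[OF 1(1)],
        rule has_Y_Dx_eq, (rule has_Y_intros)+)
      (simp add: jet_xx_def Dm_def eval_nat_numeral field_simps)
  show xy: "(\<lambda>u. u (1, 1)) \<doteq> (\<lambda>u. rho u ^ 2 * jet_xy (Sm u) (Sp u) (Dm u) (tau1 u))"
    by (rule on_shell_eq_trans[OF 1(2)],
        rule has_Y_Dx_eq, (rule has_Y_intros)+)
      (simp add: jet_xy_def Dm_def eval_nat_numeral field_simps)
  show xxx: "(\<lambda>u. u (3, 0)) \<doteq> (\<lambda>u. rho u ^ 5 * jet_xxx (Sm u) (Sp u) (Dm u) (tau1 u) (Em u) (tau2 u))"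
    by (rule on_shell_eq_trans[OF xx[THEN on_shell_eq_Dx, unfolded D]], unfold jet_xx_def,
        rule has_Y_Dx_eq, (rule has_Y_intros has_Y_Dm)+)
      (simp add: jet_xxx_def Dm_def eval_nat_numeral field_simps)
  show xxy: "(\<lambda>u. u (2, 1)) \<doteq> (\<lambda>u. rho u ^ 3 * jet_xxy (Sm u) (Sp u) (Dm u) (tau1 u) (Em u) (tau2 u))"
    by (rule on_shell_eq_trans[OF xy[THEN on_shell_eq_Dx, unfolded D]], unfold jet_xy_def,
        rule has_Y_Dx_eq, (rule has_Y_intros has_Y_Dm)+)
      (simp add: jet_xxy_def Dm_def eval_nat_numeral field_simps)
qed

text \<open>The same polynomials serve for 1/z. The discrete symmetry fixes S and \<open>Yp\<close>
  and negates T and \<open>Ym\<close>, so D, t and q change sign, while E, with two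
  \<open>Ym\<close> on S, does not.\<close>

lemma inv_z_jets_on_shell:
  "Dy (Dy inv_z) \<doteq> (\<lambda>u. irho u ^ 4 * jet_xx (Sm u) (- Sp u) (- Dm u) (- tau1 u))"
  "Dy (Dx inv_z) \<doteq> (\<lambda>u. irho u ^ 2 * jet_xy (Sm u) (- Sp u) (- Dm u) (- tau1 u))"
  "Dy (Dy (Dy inv_z)) \<doteq>
    (\<lambda>u. irho u ^ 5 * jet_xxx (Sm u) (- Sp u) (- Dm u) (- tau1 u) (Em u) (- tau2 u))"
  "Dy (Dy (Dx inv_z)) \<doteq>
    (\<lambda>u. irho u ^ 3 * jet_xxy (Sm u) (- Sp u) (- Dm u) (- tau1 u) (Em u) (- tau2 u))"
proof -
  have "Dy inv_z \<doteq> (\<lambda>u. irho u ^ 3 * (Sm u - Sp u))" "Dx inv_z \<doteq> (\<lambda>u. irho u * (- Sp u - Sm u))"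
    by (rule on_shell_eq_dom, intro Dx_elem Dy_elem inv_z_elem, erule inv_z_jets)+
  note 1 = this[THEN on_shell_eq_Dy]
  show xx: "Dy (Dy inv_z) \<doteq> (\<lambda>u. irho u ^ 4 * jet_xx (Sm u) (- Sp u) (- Dm u) (- tau1 u))"
    by (rule on_shell_eq_trans[OF 1(1)],
        rule has_Y_Dy_eq, (rule has_Y_intros)+)
      (simp add: jet_xx_def Dm_def eval_nat_numeral field_simps)
  show xy: "Dy (Dx inv_z) \<doteq> (\<lambda>u. irho u ^ 2 * jet_xy (Sm u) (- Sp u) (- Dm u) (- tau1 u))"
    by (rule on_shell_eq_trans[OF 1(2)],
        rule has_Y_Dy_eq, (rule has_Y_intros)+)
      (simp add: jet_xy_def Dm_def eval_nat_numeral field_simps)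
  show "Dy (Dy (Dy inv_z)) \<doteq>
      (\<lambda>u. irho u ^ 5 * jet_xxx (Sm u) (- Sp u) (- Dm u) (- tau1 u) (Em u) (- tau2 u))"
    by (rule on_shell_eq_trans[OF on_shell_eq_Dy[OF xx]], unfold jet_xx_def,
        rule has_Y_Dy_eq, (rule has_Y_intros has_Y_Dm)+)
      (simp add: jet_xxx_def Dm_def eval_nat_numeral field_simps)
  show "Dy (Dy (Dx inv_z)) \<doteq>
      (\<lambda>u. irho u ^ 3 * jet_xxy (Sm u) (- Sp u) (- Dm u) (- tau1 u) (Em u) (- tau2 u))"
    by (rule on_shell_eq_trans[OF on_shell_eq_Dy[OF xy]], unfold jet_xy_def,
        rule has_Y_Dy_eq, (rule has_Y_intros has_Y_Dm)+)
      (simp add: jet_xxy_def Dm_def eval_nat_numeral field_simps)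
qed

section \<open>The generator and its conjugate on the equation\<close>

lemma Z_gen_on_shell: "Z_gen \<doteq> (\<lambda>u. rho u ^ 2 * (1 / 16 * V_red u))"
proof -
  have K: "(\<lambda>u. K_num (u (0, 0)) (u (1, 0)) (u (0, 1))) \<in> elem"
    by (intro K_num_elem elem_coord z_pos)
  have 1: "Z_gen \<doteq> (\<lambda>u. Z_num (K_num (u (0, 0)) (u (1, 0)) (u (0, 1))) (u (0, 0)) (u (1, 0)) (u (0, 1))
      (rho u ^ 4 * jet_xx (Sm u) (Sp u) (Dm u) (tau1 u))
      (rho u ^ 2 * jet_xy (Sm u) (Sp u) (Dm u) (tau1 u))
      (rho u ^ 5 * jet_xxx (Sm u) (Sp u) (Dm u) (tau1 u) (Em u) (tau2 u))
      (rho u ^ 3 * jet_xxy (Sm u) (Sp u) (Dm u) (tau1 u) (Em u) (tau2 u)))"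
    unfolding Z_gen_eq[abs_def]
    by (intro Z_num_cong K elem_coord z_jets_on_shell) (auto intro: K_num_pos z_pos)
  show "Z_gen \<doteq> (\<lambda>u. rho u ^ 2 * (1 / 16 * V_red u))"
  proof (rule on_shell_eq_trans[OF 1], rule on_shell_eq_dom[OF on_shell_eq_elem(2)[OF 1]])
    fix u assume u: "u \<in> jet_domain"
    show "Z_num (K_num (u (0, 0)) (u (1, 0)) (u (0, 1))) (u (0, 0)) (u (1, 0)) (u (0, 1))
      (rho u ^ 4 * jet_xx (Sm u) (Sp u) (Dm u) (tau1 u))
      (rho u ^ 2 * jet_xy (Sm u) (Sp u) (Dm u) (tau1 u))
      (rho u ^ 5 * jet_xxx (Sm u) (Sp u) (Dm u) (tau1 u) (Em u) (tau2 u))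
      (rho u ^ 3 * jet_xxy (Sm u) (Sp u) (Dm u) (tau1 u) (Em u) (tau2 u))
      = rho u ^ 2 * (1 / 16 * V_red u)"
      unfolding z_jets[OF u] Dm_def Em_def Z_num_on_shell[OF rho_pos[OF u] Cm_pos Cm_sq] V_red_def
      by simp
  qed
qed

lemma conjugate_Z_gen_eq:
  "conjugate Z_gen u = - (u (0, 0))\<^sup>2 * Z_num (K_num (inv_z u) (Dy inv_z u) (Dx inv_z u))
    (inv_z u) (Dy inv_z u) (Dx inv_z u) (Dy (Dy inv_z) u) (Dy (Dx inv_z) u)
    (Dy (Dy (Dy inv_z)) u) (Dy (Dy (Dx inv_z)) u)"
  by (simp add: conjugate_def Z_gen_eq swap_jet_def inv_z_def[abs_def, symmetric] eval_nat_numeral)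

text \<open>Under the discrete symmetry w and T change sign and \<open>w2\<close> does not, so V =
  w2 + T w is invariant. The factor -z^2 then turns V / (16 z) into -z V / 16.\<close>

lemma conjugate_Z_gen_on_shell: "conjugate Z_gen \<doteq> (\<lambda>u. rho u ^ 2 * (- 1 / 16 * V_red u))"
proof -
  have inv_z_pos: "inv_z u > 0" if "u \<in> jet_domain" for u
    using z_pos[OF that] by (simp add: inv_z_def)
  have K: "(\<lambda>u. K_num (inv_z u) (Dy inv_z u) (Dx inv_z u)) \<in> elem"
    by (intro K_num_elem inv_z_elem Dx_elem Dy_elem inv_z_pos)
  have 1: "conjugate Z_gen \<doteq> (\<lambda>u. - (u (0, 0))\<^sup>2 *
      Z_num (K_num (inv_z u) (Dy inv_z u) (Dx inv_z u)) (inv_z u) (Dy inv_z u) (Dx inv_z u)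
      (irho u ^ 4 * jet_xx (Sm u) (- Sp u) (- Dm u) (- tau1 u))
      (irho u ^ 2 * jet_xy (Sm u) (- Sp u) (- Dm u) (- tau1 u))
      (irho u ^ 5 * jet_xxx (Sm u) (- Sp u) (- Dm u) (- tau1 u) (Em u) (- tau2 u))
      (irho u ^ 3 * jet_xxy (Sm u) (- Sp u) (- Dm u) (- tau1 u) (Em u) (- tau2 u)))"
    unfolding conjugate_Z_gen_eq[abs_def]
    by (intro on_shell_eq_mult[OF on_shell_eq_refl] Z_num_cong K inv_z_elem Dx_elem Dy_elem
        inv_z_jets_on_shell elem_intros)
      (auto intro: K_num_pos inv_z_pos)
  show "conjugate Z_gen \<doteq> (\<lambda>u. rho u ^ 2 * (- 1 / 16 * V_red u))"
  proof (rule on_shell_eq_trans[OF 1], rule on_shell_eq_dom[OF on_shell_eq_elem(2)[OF 1]])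
    fix u assume u: "u \<in> jet_domain"
    have r: "irho u > 0" using rho_pos[OF u] by (simp add: irho_def)
    have z: "- (u (0, 0))\<^sup>2 * (irho u ^ 2 * x / 16) = rho u ^ 2 * (- 1 / 16 * x)" for x
      using irho_rho[OF u] unfolding rho_sq[OF u, symmetric] by (simp add: field_simps; algebra)
    \<comment> \<open>This is \<open>Z_num_on_shell\<close> at s = \<open>irho u\<close>, with S and
      v kept and T, w, t, q negated.\<close>
    have "Z_num (K_num (irho u ^ 2) (irho u ^ 3 * (Sm u + - Sp u)) (irho u * (- Sp u - Sm u)))
      (irho u ^ 2) (irho u ^ 3 * (Sm u + - Sp u)) (irho u * (- Sp u - Sm u))
      (irho u ^ 4 * jet_xx (Sm u) (- Sp u) (Cm u ^ 3 * (- w1 u)) (- tau1 u))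
      (irho u ^ 2 * jet_xy (Sm u) (- Sp u) (Cm u ^ 3 * (- w1 u)) (- tau1 u))
      (irho u ^ 5 * jet_xxx (Sm u) (- Sp u) (Cm u ^ 3 * (- w1 u)) (- tau1 u)
        (3 * Sm u * Cm u ^ 4 * (- w1 u)\<^sup>2 + Cm u ^ 3 * w2 u) (- tau2 u))
      (irho u ^ 3 * jet_xxy (Sm u) (- Sp u) (Cm u ^ 3 * (- w1 u)) (- tau1 u)
        (3 * Sm u * Cm u ^ 4 * (- w1 u)\<^sup>2 + Cm u ^ 3 * w2 u) (- tau2 u))
      = irho u ^ 2 * V_red u / 16"
      unfolding Z_num_on_shell[OF r Cm_pos Cm_sq] V_red_def by simp
    then show "- (u (0, 0))\<^sup>2 *
      Z_num (K_num (inv_z u) (Dy inv_z u) (Dx inv_z u)) (inv_z u) (Dy inv_z u) (Dx inv_z u)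
      (irho u ^ 4 * jet_xx (Sm u) (- Sp u) (- Dm u) (- tau1 u))
      (irho u ^ 2 * jet_xy (Sm u) (- Sp u) (- Dm u) (- tau1 u))
      (irho u ^ 5 * jet_xxx (Sm u) (- Sp u) (- Dm u) (- tau1 u) (Em u) (- tau2 u))
      (irho u ^ 3 * jet_xxy (Sm u) (- Sp u) (- Dm u) (- tau1 u) (Em u) (- tau2 u))
      = rho u ^ 2 * (- 1 / 16 * V_red u)"
      unfolding inv_z_jets[OF u] Dm_def Em_def z[symmetric] by simp
  qed
qed

section \<open>Order of the generators\<close>

lemma D_D_inv_z:
  assumes u: "u \<in> jet_domain"
  shows "Dy (Dy inv_z) u = 2 * inv_z u ^ 3 * (u (0, 1))\<^sup>2 - (inv_z u)\<^sup>2 * u (0, 2)"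
    "Dy (Dx inv_z) u = 2 * inv_z u ^ 3 * u (1, 0) * u (0, 1) - (inv_z u)\<^sup>2 * u (1, 1)"
  by (subst Dy_cong[OF Dy_inv_z u] Dy_cong[OF Dx_inv_z u], assumption,
      simp add: u D_rules Dy_inv_z inv_z_elem elem_intros algebra_simps power2_eq_square
        power3_eq_cube numeral_2_eq_2)+

lemma D_D_D_inv_z:
  assumes u: "u \<in> jet_domain"
  shows "Dy (Dy (Dy inv_z)) u =
      6 * inv_z u ^ 3 * u (0, 1) * u (0, 2) - 6 * inv_z u ^ 4 * u (0, 1) ^ 3 - (inv_z u)\<^sup>2 * u (0, 3)"
    "Dy (Dy (Dx inv_z)) u =
      2 * inv_z u ^ 3 * (2 * u (1, 1) * u (0, 1) + u (1, 0) * u (0, 2))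
        - 6 * inv_z u ^ 4 * (u (0, 1))\<^sup>2 * u (1, 0) - (inv_z u)\<^sup>2 * u (1, 2)"
  by (subst Dy_cong[OF D_D_inv_z(1) u] Dy_cong[OF D_D_inv_z(2) u], assumption,
      simp add: u D_rules Dy_inv_z inv_z_elem elem_intros algebra_simps eval_nat_numeral)+

lemma Dx_depends_on: "depends_on P F \<Longrightarrow> P \<subseteq> Q \<Longrightarrow> (\<And>i j. (i, j) \<in> P \<Longrightarrow> (i + 1, j) \<in> Q) \<Longrightarrow>
    depends_on Q (Dx F)"
  and Dy_depends_on: "depends_on P F \<Longrightarrow> P \<subseteq> Q \<Longrightarrow> (\<And>i j. (i, j) \<in> P \<Longrightarrow> (i, j + 1) \<in> Q) \<Longrightarrow>
    depends_on Q (Dy F)"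
  unfolding Dx_total_deriv Dy_total_deriv by (rule total_deriv_depends_on, assumption, assumption, force)+

lemma depends_up_to_D:
  assumes "depends_up_to n F"
  shows "depends_up_to (Suc n) (Dx F)" "depends_up_to (Suc n) (Dy F)"
  using assms unfolding depends_up_to_iff by (auto elim: Dx_depends_on Dy_depends_on)

lemma depends_up_to_mono: "depends_up_to m F \<Longrightarrow> m \<le> n \<Longrightarrow> depends_up_to n F"
  unfolding depends_up_to_iff by (auto elim: depends_on_mono)

lemma third_order_Z_gen: "third_order Z_gen"
proof -
  \<comment> \<open>At z = 1 with all derivatives zero, K = 2, so the coefficient z^3 / K^3 of z_xxx
    is 1/8. Order is a property over all of \<open>jet_domain\<close>, so the witnesses may lie off
    the equation.\<close>
  define u :: jet where "u = (\<lambda>p. if p = (0, 0) then 1 else 0)"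
  define v where "v = u((3, 0) := 1)"
  have "Z_gen u = 0" "Z_gen v = 1 / 8"
    by (simp_all add: Z_gen_eq u_def v_def Z_num_def K_num_def)
  moreover have uv: "u \<in> jet_domain" "v \<in> jet_domain" "\<forall>i j. i + j \<le> 2 \<longrightarrow> u (i, j) = v (i, j)"
    by (auto simp: u_def v_def jet_domain_def)
  ultimately have "Z_gen u \<noteq> Z_gen v" by simp
  then have "\<not> depends_up_to 2 Z_gen"
    unfolding depends_up_to_def using uv by blast
  moreover have "depends_up_to 3 Z_gen"
    unfolding depends_up_to_def Z_gen_eq by simp
  ultimately show ?thesis by (simp add: third_order_def)
qed

lemma depends_up_to_inv_z: "depends_up_to 0 inv_z"
  by (simp add: depends_up_to_def inv_z_def)

lemma third_order_conjugate_Z_gen: "third_order (conjugate Z_gen)"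
proof -
  define u :: jet where "u = (\<lambda>p. if p = (0, 0) then 1 else 0)"
  \<comment> \<open>Conjugation puts z_yyy in the place of z_xxx. At this jet the third y-derivative
    of 1/z is -1, and the factor -z^2 restores the sign.\<close>
  define v where "v = u((0, 3) := 1)"
  have uv: "u \<in> jet_domain" "v \<in> jet_domain" "\<forall>i j. i + j \<le> 2 \<longrightarrow> u (i, j) = v (i, j)"
    by (auto simp: u_def v_def jet_domain_def)
  have "conjugate Z_gen u = 0" "conjugate Z_gen v = 1 / 8"
    unfolding conjugate_Z_gen_eq D_D_inv_z[OF uv(1)] D_D_D_inv_z[OF uv(1)] Dx_inv_z[OF uv(1)] Dy_inv_z[OF uv(1)]
      D_D_inv_z[OF uv(2)] D_D_D_inv_z[OF uv(2)] Dx_inv_z[OF uv(2)] Dy_inv_z[OF uv(2)]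
    by (simp_all add: u_def v_def Z_num_def K_num_def inv_z_def)
  then have "conjugate Z_gen u \<noteq> conjugate Z_gen v" by simp
  then have "\<not> depends_up_to 2 (conjugate Z_gen)"
    unfolding depends_up_to_def using uv by blast
  moreover have "depends_up_to 3 (conjugate Z_gen)"
  proof -
    have *: "depends_up_to 3 inv_z" "depends_up_to 3 (Dy inv_z)" "depends_up_to 3 (Dx inv_z)"
      "depends_up_to 3 (Dy (Dy inv_z))" "depends_up_to 3 (Dy (Dx inv_z))"
      "depends_up_to 3 (Dy (Dy (Dy inv_z)))" "depends_up_to 3 (Dy (Dy (Dx inv_z)))"
      by (rule depends_up_to_mono, ((rule depends_up_to_D)+)?, rule depends_up_to_inv_z, simp)+
    show ?thesis
      unfolding depends_up_to_def
    proof (intro ballI impI)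
      fix u v assume uv: "u \<in> jet_domain" "v \<in> jet_domain" "\<forall>i j. i + j \<le> 3 \<longrightarrow> u (i, j) = v (i, j)"
      then have "F u = F v" if "depends_up_to 3 F" for F
        using that unfolding depends_up_to_def by blast
      note this[OF *(1)] this[OF *(2)] this[OF *(3)] this[OF *(4)] this[OF *(5)] this[OF *(6)] this[OF *(7)]
      moreover have "u (0, 0) = v (0, 0)" using uv(3) by simp
      ultimately show "conjugate Z_gen u = conjugate Z_gen v"
        by (simp only: conjugate_Z_gen_eq)
    qed
  qed
  ultimately show ?thesis by (simp add: third_order_def)
qed

section \<open>Jets on the equation\<close>

lemma funpow_D_cae:
  assumes G: "G \<in> elem" and c: "\<And>u. u \<in> jet_domain \<Longrightarrow> F u = u (0, 2) + G u" and u: "u \<in> jet_domain"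
  shows "(Dx ^^ i) ((Dy ^^ j) F) u = u (i, j + 2) + (Dx ^^ i) ((Dy ^^ j) G) u"
  using u
proof (induction i arbitrary: u)
  case 0
  then show ?case
  proof (induction j arbitrary: u)
    case (Suc j)
    have "Dy ((Dy ^^ j) F) u = Dy (\<lambda>u. u (0, j + 2) + (Dy ^^ j) G u) u"
      by (rule Dy_cong) (use Suc in auto)
    then show ?case
      using funpow_D_elem[OF G, of 0 j] Suc.prems by (simp add: D_rules elem_coord)
  qed (simp add: c numeral_2_eq_2)
next
  case (Suc i)
  have "Dx ((Dx ^^ i) ((Dy ^^ j) F)) u = Dx (\<lambda>u. u (i, j + 2) + (Dx ^^ i) ((Dy ^^ j) G) u) u"
    by (rule Dx_cong) (use Suc in auto)
  then show ?case
    using funpow_D_elem[OF G, of i j] Suc.prems by (simp add: D_rules elem_coord)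
qed

text \<open>Only \<open>Dy\<close> raises the order in y, by at most one each time. Hence the
  remainder of a prolonged equation stays below the y-order j + 2 of its leading coordinate.\<close>

lemma funpow_D_depends_on:
  assumes "depends_on {p. snd p \<le> 0} F"
  shows "depends_on {p. snd p \<le> j} ((Dx ^^ i) ((Dy ^^ j) F))"
proof (induction i)
  case 0
  show ?case
  proof (induction j)
    case (Suc j)
    then have "depends_on {p. snd p \<le> Suc j} (Dy ((Dy ^^ j) F))"
      by (intro Dy_depends_on) auto
    then show ?case by simp
  qed (use assms in simp)
next
  case (Suc i)
  then have "depends_on {p. snd p \<le> j} (Dx ((Dx ^^ i) ((Dy ^^ j) F)))"
    by (rule Dx_depends_on) auto
  then show ?case by simp
qed

(* Cauchy problem on formal jets: the equation and its prolongations are solved for u (i, j + 2) in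
   terms of coordinates of y-order at most j. *)
lemma cae_jets_initial:
  assumes h: "h \<in> jet_domain"
  shows "\<exists>u\<in>cae_jets. \<forall>i. \<forall>j\<le>1. u (i, j) = h (i, j)"
proof -
  define G where "G = (\<lambda>u. Dx (Dx inv_z) u + 2)"
  have G: "G \<in> elem" unfolding G_def by (intro elem_intros Dx_elem inv_z_elem)
  have "depends_on {p. snd p \<le> 0} (Dx (Dx inv_z))"
    by (intro Dx_depends_on[where P = "{p. snd p \<le> 0}"]) (auto simp: depends_on_def inv_z_def)
  from depends_on_cong2[OF this this] have depG: "depends_on {p. snd p \<le> 0} G"
    by (simp add: G_def)
  \<comment> \<open>Stage \<open>Suc j\<close> fills in the coordinates of y-order j + 2 from stage
    \<open>j\<close>, whose coordinates of y-order up to j + 1 are already final.\<close>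
  define U where "U = rec_nat h (\<lambda>j v. \<lambda>(i, l). if l = j + 2 then - (Dx ^^ i) ((Dy ^^ j) G) v else v (i, l))"
  have U_0: "U 0 = h"
    and U_Suc: "U (Suc j) (i, l) = (if l = j + 2 then - (Dx ^^ i) ((Dy ^^ j) G) (U j) else U j (i, l))"
    for i j l by (simp_all add: U_def)
  have U_stable: "U (m + k) (i, l) = U m (i, l)" if "l \<le> m + 1" for m k i l
    using that by (induction k) (simp_all add: U_Suc)
  \<comment> \<open>The limit jet: a coordinate of y-order \<open>l\<close> no longer changes from
    stage \<open>l\<close> on.\<close>
  define u where "u = (\<lambda>(i, l). U l (i, l))"
  have u_U: "u (i, l) = U j (i, l)" if "l \<le> j + 1" for i j l
  proof (cases "l \<le> j")
    case True
    then show ?thesis using U_stable[of l l "j - l" i] by (simp add: u_def)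
  next
    case False
    then show ?thesis using U_stable[of l j 1 i] that by (simp add: u_def not_less_eq_eq)
  qed
  have initial: "u (i, l) = h (i, l)" if "l \<le> 1" for i l
    using u_U[of l 0 i] that by (simp add: U_0)
  have dom: "u \<in> jet_domain" "U j \<in> jet_domain" for j
    using h initial[of 0 0] u_U[of 0 j 0] by (simp_all add: jet_domain_def)
  have "(Dx ^^ i) ((Dy ^^ j) cae) u = 0" for i j
  proof -
    have "(Dx ^^ i) ((Dy ^^ j) G) u = (Dx ^^ i) ((Dy ^^ j) G) (U j)"
      by (rule depends_onD[OF funpow_D_depends_on[OF depG] dom]) (auto intro: u_U)
    moreover have "u (i, j + 2) = - (Dx ^^ i) ((Dy ^^ j) G) (U j)"
      using u_U[of "j + 2" "Suc j" i] by (simp add: U_Suc)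
    moreover have "(Dx ^^ i) ((Dy ^^ j) cae) u = u (i, j + 2) + (Dx ^^ i) ((Dy ^^ j) G) u"
      by (rule funpow_D_cae[OF G _ dom(1)]) (simp add: cae_eq_inv_z G_def)
    ultimately show ?thesis by simp
  qed
  then have "u \<in> cae_jets" using dom by (simp add: cae_jets_def)
  then show ?thesis using initial by blast
qed

text \<open>Distinctness is tested on the equation, where different expressions may coincide. There
  the conjugate is -Z, so any point of the equation with Z nonzero will do.\<close>

lemma conjugate_Z_gen_neq: "\<exists>u\<in>cae_jets. conjugate Z_gen u \<noteq> Z_gen u"
proof -
  \<comment> \<open>Z involves only coordinates of y-order at most 1, so these Cauchy data fix its
    value: K = 2 and z_xxx = 1 give 1/8.\<close>
  define h :: jet where "h = (\<lambda>p. if p = (0, 0) \<or> p = (3, 0) then 1 else 0)"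
  have "h \<in> jet_domain" by (simp add: h_def jet_domain_def)
  then obtain u where u: "u \<in> cae_jets" and init: "\<And>i j. j \<le> 1 \<Longrightarrow> u (i, j) = h (i, j)"
    using cae_jets_initial by blast
  have dom: "u \<in> jet_domain" using u by (simp add: cae_jets_def)
  have "Z_gen u = 1 / 8"
    by (simp add: Z_gen_eq init h_def Z_num_def K_num_def)
  \<comment> \<open>\<open>V_red\<close> contains derivatives such as z_yyy that are not among the
    Cauchy data; its value is read off from that of Z.\<close>
  moreover have "V_red u = 2"
  proof -
    have "Z_gen u = rho u ^ 2 * (1 / 16 * V_red u)"
      by (rule on_shell_eq_eq[OF Z_gen_on_shell u])
    moreover have "rho u = 1" by (simp add: rho_def init h_def)
    ultimately show ?thesis using \<open>Z_gen u = 1 / 8\<close> by simp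
  qed
  then have "conjugate Z_gen u = - 1 / 8"
    using on_shell_eq_eq[OF conjugate_Z_gen_on_shell u] by (simp add: rho_def init h_def)
  ultimately show ?thesis using u by force
qed

theorem mainTheorem2:
  shows "symmetry_generator Z_gen \<and> third_order Z_gen \<and>
    symmetry_generator (conjugate Z_gen) \<and> third_order (conjugate Z_gen) \<and>
    (\<exists>u\<in>cae_jets. conjugate Z_gen u \<noteq> Z_gen u)"
  using symmetry_generatorI[OF Z_gen_on_shell] symmetry_generatorI[OF conjugate_Z_gen_on_shell]
    third_order_Z_gen third_order_conjugate_Z_gen conjugate_Z_gen_neq
  by blast

end
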